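(* Let $1\to Z\to G\to Q\to 1$ be a central extension, where $G$ and $Q$ are compactly generated locally compact groups ($Z$ is a closed central subgroup of $G$ and $Q=G/Z$). Let $\omega$ be a nonprincipal ultrafilter on the set of positive integers. Endow $G$ with the word metric with respect to a compact generating subset, $Q$ with the word metric with respect to a compact generating subset, and $Z$ with the restriction of the metric of $G$. If $\mathrm{Cone}_\omega(G)$ is simply connected and $\mathrm{Cone}_\omega(Z)$ is ultrametric, then there is a group isomorphism $$\pi_1(\mathrm{Cone}_\omega(Q))\simeq \mathrm{Cone}_\omega(Z).$$
   Context: Asymptotic cone: for a metric space $(X,d)$ with base-point $x_0$ and a nonprincipal ultrafilter $\omega$ on the set $\mathbf{N}$ of positive integers, let $\mathrm{Precone}(X)$ be the set of sequences $(x_n)$ in $X$ with $\limsup_n d(x_n,x_0)/n<\infty$, with pseudo-distance $d_\omega(x,y)=\lim_\omega \frac1n d(x_n,y_n)$. Then $\mathrm{Cone}_\omega(X)$ is the metric space obtained by identifying points at pseudo-distance $0$. If $X$ is an abelian group with an invariant metric, then $\mathrm{Cone}_\omega(X)$ is naturally a group (termwise operations on sequences) with a bi-invariant distance; this is the group structure used on $\mathrm{Cone}_\omega(Z)$. A metric is ultrametric if $d(x,z)\le\max(d(x,y),d(y,z))$ for all $x,y,z$. *)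

theory Defs
  imports "HOL-Analysis.Analysis" "HOL-Algebra.Generated_Groups"
begin

subsection \<open>Locally compact groups and central extensions\<close>

definition locally_compact_group :: "('a, 'm) monoid_scheme \<Rightarrow> 'a topology \<Rightarrow> bool" where
  "locally_compact_group G T \<longleftrightarrow>
     group G \<and> topspace T = carrier G \<and>
     continuous_map (prod_topology T T) T (\<lambda>(x, y). x \<otimes>\<^bsub>G\<^esub> y) \<and>
     continuous_map T T (\<lambda>x. inv\<^bsub>G\<^esub> x) \<and>
     Hausdorff_space T \<and> locally_compact_space T"

definition compact_generating_set ::
    "('a, 'm) monoid_scheme \<Rightarrow> 'a topology \<Rightarrow> 'a set \<Rightarrow> bool" where
  "compact_generating_set G T S \<longleftrightarrow> compactin T S \<and> generate G S = carrier G"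

(* The quotient map condition says that Q is G/Z as a topological group, not just as a
   group: p is surjective and the topology of Q is the quotient topology. *)
definition central_extension ::
    "'a set \<Rightarrow> ('a, 'm) monoid_scheme \<Rightarrow> 'a topology \<Rightarrow>
     ('b, 'n) monoid_scheme \<Rightarrow> 'b topology \<Rightarrow> ('a \<Rightarrow> 'b) \<Rightarrow> bool" where
  "central_extension Z G TG Q TQ p \<longleftrightarrow>
     subgroup Z G \<and> closedin TG Z \<and>
     (\<forall>z\<in>Z. \<forall>g\<in>carrier G. z \<otimes>\<^bsub>G\<^esub> g = g \<otimes>\<^bsub>G\<^esub> z) \<and>
     p \<in> hom G Q \<and> kernel G Q p = Z \<and> quotient_map TG TQ p"

subsection \<open>Word metrics\<close>

definition word_length :: "('a, 'm) monoid_scheme \<Rightarrow> 'a set \<Rightarrow> 'a \<Rightarrow> nat" where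
  "word_length G S g =
     (LEAST n. \<exists>ws. length ws = n \<and> set ws \<subseteq> S \<union> (\<lambda>s. inv\<^bsub>G\<^esub> s) ` S \<and>
                    foldr (\<lambda>x y. x \<otimes>\<^bsub>G\<^esub> y) ws \<one>\<^bsub>G\<^esub> = g)"

(* The type of metrics asks for symmetry and nonnegativity off the carrier too; hence the 0. *)
definition word_dist :: "('a, 'm) monoid_scheme \<Rightarrow> 'a set \<Rightarrow> 'a \<Rightarrow> 'a \<Rightarrow> real" where
  "word_dist G S x y =
     (if x \<in> carrier G \<and> y \<in> carrier G then real (word_length G S (inv\<^bsub>G\<^esub> x \<otimes>\<^bsub>G\<^esub> y)) else 0)"

definition word_metric :: "('a, 'm) monoid_scheme \<Rightarrow> 'a set \<Rightarrow> 'a metric" where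
  "word_metric G S = metric (carrier G, word_dist G S)"

lemma (in group) foldr_mult_closed:
  "set ws \<subseteq> carrier G \<Longrightarrow> foldr (\<lambda>x y. x \<otimes> y) ws \<one> \<in> carrier G"
  by (induction ws) auto

lemma (in group) foldr_mult_append:
  "set us \<subseteq> carrier G \<Longrightarrow> set vs \<subseteq> carrier G \<Longrightarrow>
   foldr (\<lambda>x y. x \<otimes> y) (us @ vs) \<one> = foldr (\<lambda>x y. x \<otimes> y) us \<one> \<otimes> foldr (\<lambda>x y. x \<otimes> y) vs \<one>"
  by (induction us) (auto simp: m_assoc foldr_mult_closed)

lemma (in group) foldr_mult_inv:
  "set us \<subseteq> carrier G \<Longrightarrow>
   foldr (\<lambda>x y. x \<otimes> y) (rev (map (\<lambda>s. inv s) us)) \<one> = inv (foldr (\<lambda>x y. x \<otimes> y) us \<one>)"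
proof (induction us)
  case (Cons a us)
  have "set (rev (map (\<lambda>s. inv s) us)) \<subseteq> carrier G" using Cons.prems by auto
  then show ?case
    using Cons by (simp add: foldr_mult_append inv_mult_group foldr_mult_closed del: foldr_append)
qed simp

context group
begin

context
  fixes S assumes S: "S \<subseteq> carrier G" "generate G S = carrier G"
begin

lemma symm_subset: "S \<union> (\<lambda>s. inv s) ` S \<subseteq> carrier G"
  using S by auto

lemma word_exists:
  assumes "g \<in> carrier G"
  shows "\<exists>ws. set ws \<subseteq> S \<union> (\<lambda>s. inv s) ` S \<and> foldr (\<lambda>x y. x \<otimes> y) ws \<one> = g"
proof -
  have "g \<in> generate G S" using assms S by simp
  then show ?thesis
  proof (induction rule: generate.induct)
    case one
    show ?case by (rule exI[of _ "[]"]) simp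
  next
    case (incl h)
    then show ?case using S by (intro exI[of _ "[h]"]) auto
  next
    case (inv h)
    then show ?case using S by (intro exI[of _ "[inv h]"]) auto
  next
    case (eng h1 h2)
    then obtain us vs where "set us \<subseteq> S \<union> (\<lambda>s. inv s) ` S" "foldr (\<lambda>x y. x \<otimes> y) us \<one> = h1"
      "set vs \<subseteq> S \<union> (\<lambda>s. inv s) ` S" "foldr (\<lambda>x y. x \<otimes> y) vs \<one> = h2" by blast
    moreover have "set us \<subseteq> carrier G" "set vs \<subseteq> carrier G" using calculation symm_subset by auto
    ultimately show ?case
      by (intro exI[of _ "us @ vs"]) (simp add: foldr_mult_append del: foldr_append)
  qed
qed

lemma word_length_witness:
  assumes "g \<in> carrier G"
  shows "\<exists>ws. length ws = word_length G S g \<and> set ws \<subseteq> S \<union> (\<lambda>s. inv s) ` S \<and>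
              foldr (\<lambda>x y. x \<otimes> y) ws \<one> = g"
proof -
  have "\<exists>n ws. length ws = n \<and> set ws \<subseteq> S \<union> (\<lambda>s. inv s) ` S \<and> foldr (\<lambda>x y. x \<otimes> y) ws \<one> = g"
    using word_exists[OF assms] by blast
  then show ?thesis unfolding word_length_def by (rule LeastI_ex)
qed

lemma word_length_le:
  assumes "set ws \<subseteq> S \<union> (\<lambda>s. inv s) ` S" "foldr (\<lambda>x y. x \<otimes> y) ws \<one> = g"
  shows "word_length G S g \<le> length ws"
  unfolding word_length_def by (rule Least_le) (use assms in blast)

lemma word_length_eq_0_iff:
  assumes "g \<in> carrier G"
  shows "word_length G S g = 0 \<longleftrightarrow> g = \<one>"
  using word_length_witness[OF assms] word_length_le[of "[]" \<one>] by auto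

lemma word_length_mult_le:
  assumes "g \<in> carrier G" "h \<in> carrier G"
  shows "word_length G S (g \<otimes> h) \<le> word_length G S g + word_length G S h"
proof -
  obtain us where us: "length us = word_length G S g" "set us \<subseteq> S \<union> (\<lambda>s. inv s) ` S"
    "foldr (\<lambda>x y. x \<otimes> y) us \<one> = g" using word_length_witness[OF assms(1)] by blast
  obtain vs where vs: "length vs = word_length G S h" "set vs \<subseteq> S \<union> (\<lambda>s. inv s) ` S"
    "foldr (\<lambda>x y. x \<otimes> y) vs \<one> = h" using word_length_witness[OF assms(2)] by blast
  have c: "set us \<subseteq> carrier G" "set vs \<subseteq> carrier G" using us vs symm_subset by blast+
  have "foldr (\<lambda>x y. x \<otimes> y) (us @ vs) \<one> = g \<otimes> h"
    using foldr_mult_append[OF c] us vs by simp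
  then show ?thesis using word_length_le[of "us @ vs"] us vs by auto
qed

lemma word_length_inv_le:
  assumes "g \<in> carrier G"
  shows "word_length G S (inv g) \<le> word_length G S g"
proof -
  obtain us where us: "length us = word_length G S g" "set us \<subseteq> S \<union> (\<lambda>s. inv s) ` S"
    "foldr (\<lambda>x y. x \<otimes> y) us \<one> = g" using word_length_witness[OF assms] by blast
  have c: "set us \<subseteq> carrier G" using us symm_subset by blast
  have "inv u \<in> S \<union> (\<lambda>s. inv s) ` S" if u: "u \<in> set us" for u
  proof -
    consider "u \<in> S" | s where "s \<in> S" "u = inv s" using u us(2) by blast
    then show ?thesis
    proof cases
      case 2
      then show ?thesis using S(1) by auto
    qed simp
  qed
  then have "set (rev (map (\<lambda>s. inv s) us)) \<subseteq> S \<union> (\<lambda>s. inv s) ` S" by auto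
  from word_length_le[OF this] foldr_mult_inv[OF c] us show ?thesis by simp
qed

lemma word_length_inv:
  assumes "g \<in> carrier G"
  shows "word_length G S (inv g) = word_length G S g"
  using word_length_inv_le[OF assms] word_length_inv_le[of "inv g"] assms by simp

lemma Metric_space_word_dist: "Metric_space (carrier G) (word_dist G S)"
proof
  fix x y
  show "word_dist G S x y = word_dist G S y x"
  proof (cases "x \<in> carrier G \<and> y \<in> carrier G")
    case True
    then have "inv (inv x \<otimes> y) = inv y \<otimes> x" by (simp add: inv_mult_group)
    then show ?thesis using True word_length_inv[of "inv x \<otimes> y"] by (simp add: word_dist_def)
  qed (auto simp: word_dist_def)
next
  fix x y assume xy: "x \<in> carrier G" "y \<in> carrier G"
  then have "inv x \<otimes> y = \<one> \<longleftrightarrow> x = y"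
    by (metis inv_closed inv_equality inv_inv l_inv)
  then show "word_dist G S x y = 0 \<longleftrightarrow> x = y"
    using xy word_length_eq_0_iff[of "inv x \<otimes> y"] by (simp add: word_dist_def)
next
  fix x y z assume a: "x \<in> carrier G" "y \<in> carrier G" "z \<in> carrier G"
  have "(inv x \<otimes> y) \<otimes> (inv y \<otimes> z) = inv x \<otimes> z"
    using a by (metis inv_closed m_assoc m_closed r_inv l_one)
  then show "word_dist G S x z \<le> word_dist G S x y + word_dist G S y z"
    using a word_length_mult_le[of "inv x \<otimes> y" "inv y \<otimes> z"] by (simp add: word_dist_def)
qed (simp add: word_dist_def)

lemma mspace_word_metric: "mspace (word_metric G S) = carrier G"
  and mdist_word_metric: "mdist (word_metric G S) = word_dist G S"
  by (simp_all add: word_metric_def Metric_space.mspace_metric Metric_space.mdist_metric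
      Metric_space_word_dist)

end

end

subsection \<open>Asymptotic cones\<close>

(* A filter on the index set I is represented by a filter on the whole type that contains I. *)
definition nonprincipal_ultrafilter_on :: "'i set \<Rightarrow> 'i filter \<Rightarrow> bool" where
  "nonprincipal_ultrafilter_on I F \<longleftrightarrow>
     F \<noteq> bot \<and> (\<forall>\<^sub>F i in F. i \<in> I) \<and>
     (\<forall>P. (\<forall>\<^sub>F i in F. P i) \<or> (\<forall>\<^sub>F i in F. \<not> P i)) \<and>
     (\<forall>i\<in>I. \<not> (\<forall>\<^sub>F j in F. j = i))"

(* A sequence indexed by the positive integers is given by a function on all of nat. Its term
   at 0 is a dummy: it is not seen by the limit superior nor by an ultrafilter on {1..}, so two
   sequences differing only there are at pseudo-distance 0 (and x / 0 = 0 in HOL). *)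
definition precone :: "'a metric \<Rightarrow> 'a \<Rightarrow> (nat \<Rightarrow> 'a) set" where
  "precone X e =
     {x. (\<forall>n. x n \<in> mspace X) \<and> limsup (\<lambda>n. ereal (mdist X (x n) e / real n)) < \<infinity>}"

definition precone_dist :: "nat filter \<Rightarrow> 'a metric \<Rightarrow> (nat \<Rightarrow> 'a) \<Rightarrow> (nat \<Rightarrow> 'a) \<Rightarrow> real" where
  "precone_dist \<omega> X x y = Lim \<omega> (\<lambda>n. mdist X (x n) (y n) / real n)"

definition cone_rel :: "nat filter \<Rightarrow> 'a metric \<Rightarrow> 'a \<Rightarrow> ((nat \<Rightarrow> 'a) \<times> (nat \<Rightarrow> 'a)) set" where
  "cone_rel \<omega> X e = {(x, y). x \<in> precone X e \<and> y \<in> precone X e \<and> precone_dist \<omega> X x y = 0}"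

definition cone_space :: "nat filter \<Rightarrow> 'a metric \<Rightarrow> 'a \<Rightarrow> (nat \<Rightarrow> 'a) set set" where
  "cone_space \<omega> X e = precone X e // cone_rel \<omega> X e"

definition cone_dist ::
    "nat filter \<Rightarrow> 'a metric \<Rightarrow> 'a \<Rightarrow> (nat \<Rightarrow> 'a) set \<Rightarrow> (nat \<Rightarrow> 'a) set \<Rightarrow> real" where
  "cone_dist \<omega> X e A B =
     (if A \<in> cone_space \<omega> X e \<and> B \<in> cone_space \<omega> X e
      then the_elem {precone_dist \<omega> X x y | x y. x \<in> A \<and> y \<in> B} else 0)"

definition asymptotic_cone :: "nat filter \<Rightarrow> 'a metric \<Rightarrow> 'a \<Rightarrow> (nat \<Rightarrow> 'a) set metric" where
  "asymptotic_cone \<omega> X e = metric (cone_space \<omega> X e, cone_dist \<omega> X e)"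

definition cone_class :: "nat filter \<Rightarrow> 'a metric \<Rightarrow> 'a \<Rightarrow> (nat \<Rightarrow> 'a) \<Rightarrow> (nat \<Rightarrow> 'a) set" where
  "cone_class \<omega> X e x = cone_rel \<omega> X e `` {x}"

(* Meant for a metric X on an abelian group, or abelian subgroup of G, that is invariant
   under G; the base-point is the identity. *)
definition cone_group ::
    "nat filter \<Rightarrow> ('a, 'm) monoid_scheme \<Rightarrow> 'a metric \<Rightarrow> (nat \<Rightarrow> 'a) set monoid" where
  "cone_group \<omega> G X =
     \<lparr>carrier = mspace (asymptotic_cone \<omega> X \<one>\<^bsub>G\<^esub>),
      monoid.mult = (\<lambda>A B. \<Union>x\<in>A. \<Union>y\<in>B. cone_class \<omega> X \<one>\<^bsub>G\<^esub> (\<lambda>n. x n \<otimes>\<^bsub>G\<^esub> y n)),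
      one = cone_class \<omega> X \<one>\<^bsub>G\<^esub> (\<lambda>n. \<one>\<^bsub>G\<^esub>)\<rparr>"

definition ultrametric :: "'a metric \<Rightarrow> bool" where
  "ultrametric X \<longleftrightarrow>
     (\<forall>x\<in>mspace X. \<forall>y\<in>mspace X. \<forall>z\<in>mspace X. mdist X x z \<le> max (mdist X x y) (mdist X y z))"

lemma nonprincipal_ultrafilter_le_sequentially:
  assumes "nonprincipal_ultrafilter_on {1..} (\<omega> :: nat filter)"
  shows "\<omega> \<le> sequentially"
proof -
  have ne: "\<forall>\<^sub>F j in \<omega>. j \<noteq> i" for i
  proof (cases "i \<in> {1..}")
    case True
    then show ?thesis using assms unfolding nonprincipal_ultrafilter_on_def by blast
  next
    case False
    have "\<forall>\<^sub>F j in \<omega>. j \<in> {1..}" using assms unfolding nonprincipal_ultrafilter_on_def by blast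
    then show ?thesis by eventually_elim (use False in auto)
  qed
  have "\<forall>\<^sub>F j in \<omega>. j \<ge> N" for N
  proof -
    have "\<forall>\<^sub>F j in \<omega>. \<forall>i\<in>{..<N}. j \<noteq> i"
      by (subst eventually_ball_finite_distrib) (use ne in auto)
    then show ?thesis by eventually_elim (auto simp: not_less[symmetric])
  qed
  then show ?thesis
    unfolding le_filter_def eventually_sequentially by (blast intro: eventually_mono)
qed

lemma ultrafilter_bounded_tendsto:
  fixes f :: "'i \<Rightarrow> real"
  assumes "F \<noteq> bot" "\<And>P. (\<forall>\<^sub>F i in F. P i) \<or> (\<forall>\<^sub>F i in F. \<not> P i)"
    and b: "\<forall>\<^sub>F i in F. \<bar>f i\<bar> \<le> C"
  shows "(f \<longlongrightarrow> Lim F f) F"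
proof -
  let ?K = "{-C..C}"
  have "filtermap f F \<noteq> bot" using assms(1) by (simp add: filtermap_bot_iff)
  moreover have "\<forall>\<^sub>F y in filtermap f F. y \<in> ?K"
    unfolding eventually_filtermap using b by eventually_elim auto
  ultimately obtain l where l: "inf (nhds l) (filtermap f F) \<noteq> bot"
    using compact_Icc[of "-C" C] unfolding compact_filter by blast
  have "(f \<longlongrightarrow> l) F"
  proof (rule topological_tendstoI)
    fix U assume U: "open U" "l \<in> U"
    show "\<forall>\<^sub>F i in F. f i \<in> U"
    proof (rule ccontr)
      assume "\<not> ?thesis"
      then have "\<forall>\<^sub>F i in F. f i \<notin> U" using assms(2)[of "\<lambda>i. f i \<in> U"] by blast
      then have "\<forall>\<^sub>F y in filtermap f F. y \<notin> U" by (simp add: eventually_filtermap)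
      moreover have "\<forall>\<^sub>F y in nhds l. y \<in> U" using U by (rule eventually_nhds_in_open)
      ultimately have "\<forall>\<^sub>F y in inf (nhds l) (filtermap f F). False"
        unfolding eventually_inf by blast
      then show False using l by (simp add: eventually_False)
    qed
  qed
  with tendsto_Lim[OF assms(1) this] show ?thesis by simp
qed

context
  fixes \<omega> :: "nat filter" and X :: "'a metric" and e :: 'a
  assumes \<omega>: "nonprincipal_ultrafilter_on {1..} \<omega>" and e: "e \<in> mspace X"
begin

lemma precone_bounded:
  assumes "x \<in> precone X e"
  shows "\<exists>C. \<forall>\<^sub>F n in \<omega>. mdist X (x n) e / real n \<le> C"
proof -
  have "limsup (\<lambda>n. ereal (mdist X (x n) e / real n)) < \<infinity>"
    using assms by (simp add: precone_def)
  then obtain C where "limsup (\<lambda>n. ereal (mdist X (x n) e / real n)) < ereal C"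
    using ereal_dense2 by blast
  then have "\<forall>\<^sub>F n in sequentially. ereal (mdist X (x n) e / real n) < ereal C"
    by (rule Limsup_lessD)
  then have "\<forall>\<^sub>F n in \<omega>. ereal (mdist X (x n) e / real n) < ereal C"
    using nonprincipal_ultrafilter_le_sequentially[OF \<omega>] by (simp add: le_filter_def)
  then have "\<forall>\<^sub>F n in \<omega>. mdist X (x n) e / real n \<le> C" by eventually_elim simp
  then show ?thesis by blast
qed

lemma precone_dist_tendsto:
  assumes x: "x \<in> precone X e" and y: "y \<in> precone X e"
  shows "((\<lambda>n. mdist X (x n) (y n) / real n) \<longlongrightarrow> precone_dist \<omega> X x y) \<omega>"
proof -
  obtain C D where "\<forall>\<^sub>F n in \<omega>. mdist X (x n) e / real n \<le> C"
    and "\<forall>\<^sub>F n in \<omega>. mdist X (y n) e / real n \<le> D"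
    using precone_bounded[OF x] precone_bounded[OF y] by blast
  then have "\<forall>\<^sub>F n in \<omega>. \<bar>mdist X (x n) (y n) / real n\<bar> \<le> C + D"
  proof eventually_elim
    case (elim n)
    have "mdist X (x n) (y n) \<le> mdist X (x n) e + mdist X (y n) e"
      using mdist_triangle[of "x n" X e "y n"] mdist_commute[of X e "y n"] x y e
      by (simp add: precone_def)
    then have "mdist X (x n) (y n) / real n \<le> mdist X (x n) e / real n + mdist X (y n) e / real n"
      by (metis add_divide_distrib divide_right_mono of_nat_0_le_iff)
    then show ?case using elim by simp
  qed
  moreover have "(\<forall>\<^sub>F n in \<omega>. P n) \<or> (\<forall>\<^sub>F n in \<omega>. \<not> P n)" for P
    using \<omega> by (simp add: nonprincipal_ultrafilter_on_def)
  ultimately show ?thesis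
    unfolding precone_dist_def using \<omega>
    by (intro ultrafilter_bounded_tendsto) (simp_all add: nonprincipal_ultrafilter_on_def)
qed

lemma ultrafilter_ne_bot: "\<omega> \<noteq> bot"
  using \<omega> by (simp add: nonprincipal_ultrafilter_on_def)

lemma precone_dist_self: "precone_dist \<omega> X x x = 0" if "x \<in> precone X e"
proof -
  have "(\<lambda>n. mdist X (x n) (x n) / real n) = (\<lambda>n. 0)"
    using that by (auto simp: precone_def)
  then show ?thesis unfolding precone_dist_def
    by (simp add: tendsto_Lim[OF ultrafilter_ne_bot tendsto_const])
qed

lemma precone_dist_nonneg:
  assumes "x \<in> precone X e" "y \<in> precone X e"
  shows "0 \<le> precone_dist \<omega> X x y"
  by (rule tendsto_lowerbound[OF precone_dist_tendsto[OF assms] _ ultrafilter_ne_bot]) simp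

lemma precone_dist_commute: "precone_dist \<omega> X x y = precone_dist \<omega> X y x"
  unfolding precone_dist_def by (simp add: mdist_commute)

lemma precone_dist_triangle:
  assumes "x \<in> precone X e" "y \<in> precone X e" "z \<in> precone X e"
  shows "precone_dist \<omega> X x z \<le> precone_dist \<omega> X x y + precone_dist \<omega> X y z"
proof (rule tendsto_le[OF ultrafilter_ne_bot])
  show "((\<lambda>n. mdist X (x n) (y n) / real n + mdist X (y n) (z n) / real n) \<longlongrightarrow>
          precone_dist \<omega> X x y + precone_dist \<omega> X y z) \<omega>"
    by (intro tendsto_add precone_dist_tendsto assms)
  show "((\<lambda>n. mdist X (x n) (z n) / real n) \<longlongrightarrow> precone_dist \<omega> X x z) \<omega>"
    by (intro precone_dist_tendsto assms)
  have "mdist X (x n) (z n) / real n \<le> mdist X (x n) (y n) / real n + mdist X (y n) (z n) / real n"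
    for n
  proof -
    have "mdist X (x n) (z n) \<le> mdist X (x n) (y n) + mdist X (y n) (z n)"
      using mdist_triangle[of "x n" X "y n" "z n"] assms by (simp add: precone_def)
    then show ?thesis by (metis add_divide_distrib divide_right_mono of_nat_0_le_iff)
  qed
  then show "\<forall>\<^sub>F n in \<omega>. mdist X (x n) (z n) / real n
      \<le> mdist X (x n) (y n) / real n + mdist X (y n) (z n) / real n" by simp
qed

lemma equiv_cone_rel: "equiv (precone X e) (cone_rel \<omega> X e)"
proof (rule equivI)
  show "cone_rel \<omega> X e \<subseteq> precone X e \<times> precone X e" by (auto simp: cone_rel_def)
  show "refl_on (precone X e) (cone_rel \<omega> X e)"
    by (auto simp: refl_on_def cone_rel_def precone_dist_self)
  show "sym (cone_rel \<omega> X e)"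
    using precone_dist_commute by (auto simp: sym_def cone_rel_def)
  show "trans (cone_rel \<omega> X e)"
  proof (rule transI)
    fix x y z assume a: "(x, y) \<in> cone_rel \<omega> X e" "(y, z) \<in> cone_rel \<omega> X e"
    then show "(x, z) \<in> cone_rel \<omega> X e"
      using precone_dist_triangle[of x y z] precone_dist_nonneg[of x z]
      by (simp add: cone_rel_def)
  qed
qed

lemma cone_dist_class:
  assumes x: "x \<in> precone X e" and y: "y \<in> precone X e"
  shows "cone_dist \<omega> X e (cone_class \<omega> X e x) (cone_class \<omega> X e y) = precone_dist \<omega> X x y"
proof -
  let ?A = "cone_class \<omega> X e x" and ?B = "cone_class \<omega> X e y"
  have "precone_dist \<omega> X x' y' = precone_dist \<omega> X x y" if "x' \<in> ?A" "y' \<in> ?B" for x' y'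
  proof -
    have c: "x' \<in> precone X e" "y' \<in> precone X e" "precone_dist \<omega> X x x' = 0"
      "precone_dist \<omega> X y y' = 0" using that by (auto simp: cone_class_def cone_rel_def)
    show ?thesis
      using precone_dist_triangle[of x' x y'] precone_dist_triangle[of x y y']
        precone_dist_triangle[of x x' y] precone_dist_triangle[of x' y' y]
        c x y precone_dist_commute[of x x'] precone_dist_commute[of y y'] by linarith
  qed
  moreover have "x \<in> ?A" "y \<in> ?B"
    using x y by (auto simp: cone_class_def cone_rel_def precone_dist_self)
  ultimately have "{precone_dist \<omega> X x' y' | x' y'. x' \<in> ?A \<and> y' \<in> ?B} = {precone_dist \<omega> X x y}"
    by blast
  moreover have "?A \<in> cone_space \<omega> X e" "?B \<in> cone_space \<omega> X e"
    using x y by (auto simp: cone_class_def cone_space_def quotientI)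
  ultimately show ?thesis by (simp add: cone_dist_def)
qed

lemma cone_space_cases:
  assumes "A \<in> cone_space \<omega> X e"
  obtains x where "x \<in> precone X e" "A = cone_class \<omega> X e x"
  using assms unfolding cone_space_def cone_class_def by (rule quotientE)

lemma Metric_space_cone_dist: "Metric_space (cone_space \<omega> X e) (cone_dist \<omega> X e)"
proof
  fix A B
  show "0 \<le> cone_dist \<omega> X e A B"
  proof (cases "A \<in> cone_space \<omega> X e \<and> B \<in> cone_space \<omega> X e")
    case True
    then show ?thesis by (metis cone_space_cases cone_dist_class precone_dist_nonneg)
  qed (auto simp: cone_dist_def)
  show "cone_dist \<omega> X e A B = cone_dist \<omega> X e B A"
  proof (cases "A \<in> cone_space \<omega> X e \<and> B \<in> cone_space \<omega> X e")
    case True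
    then show ?thesis by (metis cone_space_cases cone_dist_class precone_dist_commute)
  qed (auto simp: cone_dist_def)
next
  fix A B assume "A \<in> cone_space \<omega> X e" "B \<in> cone_space \<omega> X e"
  then obtain x y where xy: "x \<in> precone X e" "A = cone_class \<omega> X e x"
    "y \<in> precone X e" "B = cone_class \<omega> X e y" by (metis cone_space_cases)
  have "A = B \<longleftrightarrow> (x, y) \<in> cone_rel \<omega> X e"
    using eq_equiv_class_iff[OF equiv_cone_rel xy(1,3)] xy by (simp add: cone_class_def)
  then show "cone_dist \<omega> X e A B = 0 \<longleftrightarrow> A = B"
    using xy cone_dist_class[of x y] by (simp add: cone_rel_def)
next
  fix A B C assume "A \<in> cone_space \<omega> X e" "B \<in> cone_space \<omega> X e" "C \<in> cone_space \<omega> X e"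
  then show "cone_dist \<omega> X e A C \<le> cone_dist \<omega> X e A B + cone_dist \<omega> X e B C"
    by (elim cone_space_cases) (simp add: cone_dist_class precone_dist_triangle)
qed

lemma mspace_cone: "mspace (asymptotic_cone \<omega> X e) = cone_space \<omega> X e"
  and mdist_cone: "mdist (asymptotic_cone \<omega> X e) = cone_dist \<omega> X e"
  by (simp_all add: asymptotic_cone_def Metric_space.mspace_metric Metric_space.mdist_metric
      Metric_space_cone_dist)

end

subsection \<open>The fundamental group of a topological space\<close>

definition loops :: "'a topology \<Rightarrow> 'a \<Rightarrow> (real \<Rightarrow> 'a) set" where
  "loops X b = {g. pathin X g \<and> g 0 = b \<and> g 1 = b}"

(* Paths are total functions on the reals; functions agreeing on {0..1} are identified here. *)
definition loop_homotopy :: "'a topology \<Rightarrow> 'a \<Rightarrow> ((real \<Rightarrow> 'a) \<times> (real \<Rightarrow> 'a)) set" where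
  "loop_homotopy X b =
     {(f, g). f \<in> loops X b \<and> g \<in> loops X b \<and>
              homotopic_with (\<lambda>r. r 0 = b \<and> r 1 = b) (top_of_set {0..1}) X f g}"

(* The library's joinpaths needs a type of class topological_space. *)
definition join_loops :: "(real \<Rightarrow> 'a) \<Rightarrow> (real \<Rightarrow> 'a) \<Rightarrow> real \<Rightarrow> 'a" where
  "join_loops f g = (\<lambda>t. if t \<le> 1/2 then f (2 * t) else g (2 * t - 1))"

definition fundamental_group :: "'a topology \<Rightarrow> 'a \<Rightarrow> (real \<Rightarrow> 'a) set monoid" where
  "fundamental_group X b =
     \<lparr>carrier = loops X b // loop_homotopy X b,
      monoid.mult = (\<lambda>A B. \<Union>f\<in>A. \<Union>g\<in>B. loop_homotopy X b `` {join_loops f g}),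
      one = loop_homotopy X b `` {\<lambda>t. b}\<rparr>"

definition simply_connected_space :: "'a topology \<Rightarrow> bool" where
  "simply_connected_space X \<longleftrightarrow>
     path_connected_space X \<and>
     (\<forall>b\<in>topspace X. carrier (fundamental_group X b) = {\<one>\<^bsub>fundamental_group X b\<^esub>})"

end

theory Submission
  imports Defs
begin

text \<open>
  The quotient map of the cones, from \<open>Cone(G)\<close> to \<open>Cone(Q)\<close>, behaves like a universal covering
  whose deck group is \<open>Cone(Z)\<close>, although \<open>Cone(Z)\<close> need not be discrete.

  \<^item> The cone of \<open>Z\<close> acts on the cone of \<open>G\<close> by termwise multiplication. As \<open>Z\<close> is central and word
    metrics are left invariant, the action is by isometries, and an element displaces all points
    by the same distance. By the Baire category theorem, word metrics of two
    compact generating sets are Lipschitz equivalent (\<open>word_length_comparable\<close>), so the word metric of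
    \<open>Q\<close> may be compared with the one given by the image of the generating set of \<open>G\<close>. Hence \<open>p\<close> is
    Lipschitz and lifts points with linear control on the distance. These properties pass to the
    cones, where moreover the fibres are exactly the orbits of \<open>Cone(Z)\<close>
    (\<open>ultrametric_fibration_cones\<close>).

  \<^item> Covering theory needs a substitute for discreteness of the fibres. It is provided by the
    ultrametric inequality: two sections over a path that both vary by at most \<open>e\<close> at some small
    scale differ by elements of \<open>Cone(Z)\<close> that vary by at most \<open>2e\<close> at that scale, and in an
    ultrametric space a chain of steps of size at most \<open>2e\<close> never gets further away than \<open>2e\<close>
    (\<open>coarse_lift_rigid\<close>). Thus discontinuous approximate lifts, which are easy to construct, converge
    uniformly because cones are complete, and the limit is a genuine lift of the path
    (\<open>path_lifting\<close>). The same rigidity shows that lifts depend continuously on the path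
    (\<open>lift_stable\<close>).

  \<^item> The endpoint of the lift of a loop is the translate of the base-point by an element of
    \<open>Cone(Z)\<close>, the monodromy of the loop. Along a homotopy the monodromy moves
    continuously in an ultrametric space, so it is constant. It is multiplicative under concatenation, and every element
    occurs because \<open>Cone(G)\<close> is path connected. Two loops with the same monodromy have lifts with the
    same endpoints, which are homotopic because \<open>Cone(G)\<close> is simply connected. So the monodromy
    induces the isomorphism (\<open>fundamental_group_iso\<close>).
\<close>

section \<open>Paths in metric spaces\<close>

lemma mdist_self [simp]: "x \<in> mspace m \<Longrightarrow> mdist m x x = 0"
  by simp

lemma mdist_le_0_iff [simp]: "x \<in> mspace m \<Longrightarrow> y \<in> mspace m \<Longrightarrow> mdist m x y \<le> 0 \<longleftrightarrow> x = y"
  by (metis mdist_nonneg mdist_zero order_antisym order_refl)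

lemma compact_imp_uniformly_continuous_mdist:
  fixes K :: "'k::metric_space set"
  assumes "compact K" "continuous_map (top_of_set K) (mtopology_of Y) h" "0 < e"
  obtains \<delta> where "0 < \<delta>"
    "\<And>x y. x \<in> K \<Longrightarrow> y \<in> K \<Longrightarrow> dist x y < \<delta> \<Longrightarrow> mdist Y (h x) (h y) < e"
proof -
  have K: "mtopology_of (submetric euclidean_metric K) = top_of_set K"
    by (simp add: mtopology_of_submetric)
  have "compact_space (mtopology_of (submetric euclidean_metric K))"
    using assms(1) by (simp add: K compact_space_subtopology)
  then have "uniformly_continuous_map (submetric euclidean_metric K) Y h"
    using assms(2) continuous_eq_uniformly_continuous_map[of "submetric euclidean_metric K" Y h]
    by (simp add: K)
  then show ?thesis
    using that assms(3) unfolding uniformly_continuous_map_def by simp metis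
qed

lemma UN_UN_constant:
  assumes "\<And>x y. x \<in> P \<Longrightarrow> y \<in> P' \<Longrightarrow> F x y = U" "p \<in> P" "p' \<in> P'"
  shows "(\<Union>x\<in>P. \<Union>y\<in>P'. F x y) = U"
proof -
  have "(\<Union>x\<in>P. \<Union>y\<in>P'. F x y) = (\<Union>x\<in>P. \<Union>y\<in>P'. U)" using assms(1) by simp
  also have "\<dots> = U" using assms(2,3) by auto
  finally show ?thesis .
qed

lemma pathinI_mdist:
  assumes "\<And>t. t \<in> {0..1} \<Longrightarrow> f t \<in> mspace X"
    and "\<And>e. 0 < e \<Longrightarrow> \<exists>\<delta>>0. \<forall>s\<in>{0..1}. \<forall>t\<in>{0..1}. \<bar>s - t\<bar> < \<delta> \<longrightarrow> mdist X (f s) (f t) < e"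
  shows "pathin (mtopology_of X) f"
proof -
  have "uniformly_continuous_map (submetric euclidean_metric {0..1}) X f"
    unfolding uniformly_continuous_map_def using assms
    by (auto simp: dist_real_def mdist_commute abs_minus_commute)
  then have "continuous_map (mtopology_of (submetric euclidean_metric {0..1})) (mtopology_of X) f"
    by (rule uniformly_continuous_imp_continuous_map)
  then show ?thesis
    by (simp add: pathin_def mtopology_of_submetric)
qed

lemma mcomplete_of_limit:
  assumes "mcomplete_of X" "\<And>n. u n \<in> mspace X"
    and "\<And>r. 0 < r \<Longrightarrow> \<exists>N. \<forall>j\<ge>N. \<forall>k\<ge>N. mdist X (u j) (u k) < r"
  shows "\<exists>x\<in>mspace X. (\<lambda>n. mdist X (u n) x) \<longlonglongrightarrow> 0"
proof -
  interpret Metric_space "mspace X" "mdist X" by (rule Metric_space_mspace_mdist)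
  have "MCauchy u" unfolding MCauchy_def using assms(2,3) by blast
  then obtain x where "limitin mtopology u x sequentially"
    using assms(1) unfolding mcomplete_of_def mcomplete_def by blast
  then show ?thesis by (auto simp: limitin_metric_dist_null)
qed

lemma pathin_join_loops:
  assumes f: "pathin X f" and g: "pathin X g" and fg: "f 1 = g 0"
  shows "pathin X (join_loops f g)"
  unfolding pathin_def join_loops_def
proof (rule continuous_map_cases_le[where p = "\<lambda>t. t" and q = "\<lambda>t. 1/2"])
  show "continuous_map (subtopology (top_of_set {0..1}) {x \<in> topspace (top_of_set {0..1}). x \<le> 1/2}) X (\<lambda>t. f (2 * t))"
    using f unfolding pathin_def
    by (intro continuous_map_compose[where g = f and f = "\<lambda>t. 2 * t", unfolded o_def])
      (auto intro!: continuous_intros simp: continuous_map_in_subtopology subtopology_subtopology)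
  show "continuous_map (subtopology (top_of_set {0..1}) {x \<in> topspace (top_of_set {0..1}). 1/2 \<le> x}) X (\<lambda>t. g (2 * t - 1))"
    using g unfolding pathin_def
    by (intro continuous_map_compose[where g = g and f = "\<lambda>t. 2 * t - 1", unfolded o_def])
      (auto intro!: continuous_intros simp: continuous_map_in_subtopology subtopology_subtopology)
next
  fix t :: real assume "t = 1 / 2"
  then show "f (2 * t) = g (2 * t - 1)" unfolding \<open>t = 1 / 2\<close> using fg by simp
qed auto

lemma pathin_reverse:
  assumes "pathin X g"
  shows "pathin X (\<lambda>t. g (1 - t))"
  using assms unfolding pathin_def
  by (intro continuous_map_compose[where g = g and f = "\<lambda>t. 1 - t", unfolded o_def])
    (auto intro!: continuous_intros simp: continuous_map_in_subtopology)

text \<open>Subdividing the interval makes a chain of steps of size at most \<open>e\<close>; in an ultrametric space such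
  a chain stays within \<open>e\<close> of its start. This replaces the fact that a
  continuous map from an interval to a discrete space is constant.\<close>
lemma ultrametric_chain:
  fixes b :: "real \<Rightarrow> 'c"
  assumes "ultrametric C" and b: "\<And>t. t \<in> {0..1} \<Longrightarrow> b t \<in> mspace C" and "0 < \<delta>"
    and step: "\<And>s t. s \<in> {0..1} \<Longrightarrow> t \<in> {0..1} \<Longrightarrow> \<bar>s - t\<bar> < \<delta> \<Longrightarrow> mdist C (b s) (b t) \<le> e"
    and t: "t \<in> {0..1}"
  shows "mdist C (b 0) (b t) \<le> e"
proof -
  obtain n :: nat where n: "0 < n" "inverse (real n) < \<delta>"
    using ex_inverse_of_nat_less[OF \<open>0 < \<delta>\<close>] by blast
  define s where "s k = real k * t / real n" for k
  have s: "s k \<in> {0..1}" if "k \<le> n" for k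
  proof -
    have "real k * t \<le> real n * 1" using that t by (intro mult_mono) auto
    then show ?thesis using t n by (auto simp: s_def)
  qed
  have d: "\<bar>s k - s (Suc k)\<bar> < \<delta>" for k
  proof -
    have "s (Suc k) - s k = t * inverse (real n)" by (simp add: s_def divide_simps) (simp add: algebra_simps)
    moreover have "t * inverse (real n) \<le> 1 * inverse (real n)"
      using t by (intro mult_right_mono) auto
    moreover have "0 \<le> t * inverse (real n)" using t by simp
    ultimately show ?thesis using n by linarith
  qed
  have "0 \<le> e"
    using step[of 0 0] \<open>0 < \<delta>\<close> mdist_nonneg[of C "b 0" "b 0"] by (simp del: mdist_nonneg)
  have "mdist C (b 0) (b (s k)) \<le> e" if "k \<le> n" for k
    using that
  proof (induction k)
    case 0
    then show ?case using b[of 0] \<open>0 \<le> e\<close> by (simp add: s_def)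
  next
    case (Suc k)
    have "mdist C (b 0) (b (s (Suc k)))
        \<le> max (mdist C (b 0) (b (s k))) (mdist C (b (s k)) (b (s (Suc k))))"
      using \<open>ultrametric C\<close> b s Suc.prems unfolding ultrametric_def by simp
    moreover have "mdist C (b (s k)) (b (s (Suc k))) \<le> e"
      using step s d Suc.prems by simp
    ultimately show ?case using Suc by simp
  qed
  from this[of n] n show ?thesis by (simp add: s_def)
qed

text \<open>Triviality of the fundamental group speaks of loops only. Given two paths with common ends, a
  null-homotopy of the loop that runs along the first and back along the second is a map on the unit
  square which is constant on three of its sides, and the midpoint of the fourth side is sent to
  the common final point. The required homotopy restricts this map to the segments from a point
  that travels along the three sides to that midpoint.\<close>
lemma simply_connected_imp_paths_homotopic:
  assumes sc: "simply_connected_space X"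
    and f: "pathin X f" "f 0 = x" "f 1 = y" and g: "pathin X g" "g 0 = x" "g 1 = y"
  shows "homotopic_with (\<lambda>r. r 0 = x \<and> r 1 = y) (top_of_set {0..1}) X f g"
proof -
  define r where "r = join_loops f (\<lambda>t. g (1 - t))"
  have "pathin X r"
    unfolding r_def by (rule pathin_join_loops[OF f(1) pathin_reverse[OF g(1)]]) (simp add: f g)
  then have "r \<in> loops X x" by (simp add: loops_def r_def join_loops_def f g)
  have x: "x \<in> topspace X" using path_start_in_topspace[OF f(1)] f by simp
  have "(\<lambda>t. x) \<in> loops X x" using x by (simp add: loops_def)
  then have cst: "((\<lambda>t. x), (\<lambda>t. x)) \<in> loop_homotopy X x"
    using x by (simp add: loop_homotopy_def)
  have "loop_homotopy X x `` {r} \<in> carrier (fundamental_group X x)"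
    using \<open>r \<in> loops X x\<close> by (simp add: fundamental_group_def quotientI)
  then have "loop_homotopy X x `` {r} = loop_homotopy X x `` {\<lambda>t. x}"
    using sc x unfolding simply_connected_space_def by (auto simp: fundamental_group_def)
  with cst have "(r, \<lambda>t. x) \<in> loop_homotopy X x" by blast
  then have "homotopic_with (\<lambda>r. r 0 = x \<and> r 1 = x) (top_of_set {0..1}) X r (\<lambda>t. x)"
    by (simp add: loop_homotopy_def)
  then obtain h :: "real \<times> real \<Rightarrow> _" where h: "continuous_map (prod_topology (top_of_set {0..1}) (top_of_set {0..1})) X h"
    and h0: "\<And>t. h (0, t) = r t" and h1: "\<And>t. h (1, t) = x"
    and hx: "\<And>s. s \<in> {0..1} \<Longrightarrow> h (s, 0) = x \<and> h (s, 1) = x"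
    unfolding homotopic_with_def by blast
  \<comment> \<open>The point with coordinates \<open>\<sigma>1 s\<close>, \<open>\<sigma>2 s\<close> runs along the three sides on which \<open>h\<close> is constant, from
  \<open>(0, 0)\<close> via \<open>(1, 0)\<close> and \<open>(1, 1)\<close> to \<open>(0, 1)\<close>.\<close>
  define \<sigma>1 where "\<sigma>1 s = min 1 (min (3 * s) (3 - 3 * s))" for s :: real
  define \<sigma>2 where "\<sigma>2 s = max 0 (min 1 (3 * s - 1))" for s :: real
  define k where "k = (\<lambda>(s, t). h ((1 - t) * \<sigma>1 s, (1 - t) * \<sigma>2 s + t / 2))"
  have \<sigma>: "\<sigma>1 s \<in> {0..1}" "\<sigma>2 s \<in> {0..1}" if "s \<in> {0..1}" for s
    using that by (auto simp: \<sigma>1_def \<sigma>2_def)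
  have conv: "(1 - t) * a + t * b \<in> {0..1}" if "t \<in> {0..1}" "a \<in> {0..1}" "b \<in> {0..1}" for t a b :: real
    using convexD_alt[OF convex_real_interval(5)[of 0 1], of a b t] that by simp
  have "continuous_map (top_of_set ({0..1} \<times> {0..1})) X k"
    unfolding k_def case_prod_unfold
  proof (rule continuous_map_compose[where g = h and f = "\<lambda>u. ((1 - snd u) * \<sigma>1 (fst u), (1 - snd u) * \<sigma>2 (fst u) + snd u / 2)", unfolded o_def])
    show "continuous_map (top_of_set ({0..1} \<times> {0..1})) (top_of_set ({0..1} \<times> {0..1}))
        (\<lambda>u. ((1 - snd u) * \<sigma>1 (fst u), (1 - snd u) * \<sigma>2 (fst u) + snd u / 2))"
    proof -
      have "continuous_on ({0..1} \<times> {0..1}) (\<lambda>u. ((1 - snd u) * \<sigma>1 (fst u), (1 - snd u) * \<sigma>2 (fst u) + snd u / 2))"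
        unfolding \<sigma>1_def \<sigma>2_def by (intro continuous_intros) auto
      moreover have "(1 - t) * \<sigma>1 s \<in> {0..1}" "(1 - t) * \<sigma>2 s + t / 2 \<in> {0..1}"
        if "s \<in> {0..1}" "t \<in> {0..1}" for s t
        using conv[OF that(2) \<sigma>(1)[OF that(1)], of 0] conv[OF that(2) \<sigma>(2)[OF that(1)], of "1/2"]
        by auto
      ultimately show ?thesis
        by (auto simp: continuous_map_in_subtopology)
    qed
    show "continuous_map (top_of_set ({0..1} \<times> {0..1})) X h"
      using h by (simp add: prod_topology_subtopology_eu)
  qed
  moreover have "k (0, t) = f t" "k (1, t) = g t" if "t \<in> {0..1}" for t
  proof -
    have "k (0, t) = r (t / 2)" by (simp add: k_def \<sigma>1_def \<sigma>2_def h0)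
    then show "k (0, t) = f t" using that by (simp add: r_def join_loops_def)
    have "k (1, t) = r (1 - t / 2)" by (simp add: k_def \<sigma>1_def \<sigma>2_def h0)
    then show "k (1, t) = g t" using that by (auto simp: r_def join_loops_def f g)
  qed
  moreover have "k (s, 0) = x \<and> k (s, 1) = y" if s: "s \<in> {0..1}" for s
  proof -
    have "\<sigma>1 s = 1 \<or> \<sigma>2 s = 0 \<or> \<sigma>2 s = 1"
      unfolding \<sigma>1_def \<sigma>2_def by linarith
    then have "h (\<sigma>1 s, \<sigma>2 s) = x" using \<sigma>[OF s] hx h1 by metis
    moreover have "h (0, 1 / 2) = y" by (simp add: h0 r_def join_loops_def f)
    ultimately show ?thesis by (simp add: k_def)
  qed
  ultimately show ?thesis
    by (subst homotopic_with) (auto simp: prod_topology_subtopology_eu intro!: exI[of _ k])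
qed

section \<open>Fundamental groups of quotients by ultrametric actions\<close>

text \<open>The metric content of the map from the cone of \<open>G\<close> to the cone of \<open>Q\<close>. The metric space \<open>C\<close>
  has the elements of \<open>A\<close> as points; by \<open>act_displacement\<close> every orbit is an isometric copy of it.\<close>
locale ultrametric_fibration =
  fixes X :: "'x metric" and Y :: "'y metric" and C :: "'c metric"
    and A :: "('c, 'm) monoid_scheme" and proj :: "'x \<Rightarrow> 'y" and act :: "'c \<Rightarrow> 'x \<Rightarrow> 'x"
    and L :: real
  assumes complete: "mcomplete_of X"
    and L_ge_1: "1 \<le> L"
    and proj_closed: "x \<in> mspace X \<Longrightarrow> proj x \<in> mspace Y"
    and proj_lipschitz: "x \<in> mspace X \<Longrightarrow> x' \<in> mspace X \<Longrightarrow>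
      mdist Y (proj x) (proj x') \<le> L * mdist X x x'"
    and proj_lift: "x \<in> mspace X \<Longrightarrow> y \<in> mspace Y \<Longrightarrow>
      \<exists>x'\<in>mspace X. proj x' = y \<and> mdist X x x' \<le> L * mdist Y (proj x) y"
    and fibre: "x \<in> mspace X \<Longrightarrow> x' \<in> mspace X \<Longrightarrow> proj x = proj x' \<Longrightarrow>
      \<exists>a\<in>carrier A. x' = act a x"
    and carrier_eq: "carrier A = mspace C"
    and ultrametric: "ultrametric C"
    and one_closed: "\<one>\<^bsub>A\<^esub> \<in> carrier A"
    and mult_closed: "a \<in> carrier A \<Longrightarrow> b \<in> carrier A \<Longrightarrow> a \<otimes>\<^bsub>A\<^esub> b \<in> carrier A"
    and act_closed: "a \<in> carrier A \<Longrightarrow> x \<in> mspace X \<Longrightarrow> act a x \<in> mspace X"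
    and act_one: "x \<in> mspace X \<Longrightarrow> act \<one>\<^bsub>A\<^esub> x = x"
    and act_mult: "a \<in> carrier A \<Longrightarrow> b \<in> carrier A \<Longrightarrow> x \<in> mspace X \<Longrightarrow>
      act (a \<otimes>\<^bsub>A\<^esub> b) x = act a (act b x)"
    and proj_act: "a \<in> carrier A \<Longrightarrow> x \<in> mspace X \<Longrightarrow> proj (act a x) = proj x"
    and act_isometry: "a \<in> carrier A \<Longrightarrow> x \<in> mspace X \<Longrightarrow> x' \<in> mspace X \<Longrightarrow>
      mdist X (act a x) (act a x') = mdist X x x'"
    and act_displacement: "a \<in> carrier A \<Longrightarrow> b \<in> carrier A \<Longrightarrow> x \<in> mspace X \<Longrightarrow>
      mdist X (act a x) (act b x) = mdist C a b"
begin

text \<open>Continuity is relaxed to an oscillation of at most \<open>e\<close> at scale \<open>\<delta>\<close>, so that lifts may be chosen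
  pointwise.\<close>
definition coarse_lift :: "(real \<Rightarrow> 'y) \<Rightarrow> real \<Rightarrow> real \<Rightarrow> (real \<Rightarrow> 'x) \<Rightarrow> bool" where
  "coarse_lift \<gamma> e \<delta> f \<longleftrightarrow> 0 < \<delta> \<and> (\<forall>t\<in>{0..1}. f t \<in> mspace X \<and> proj (f t) = \<gamma> t) \<and>
     (\<forall>s\<in>{0..1}. \<forall>t\<in>{0..1}. \<bar>s - t\<bar> < \<delta> \<longrightarrow> mdist X (f s) (f t) \<le> e)"

lemma coarse_lift_mono: "coarse_lift \<gamma> e \<delta> f \<Longrightarrow> e \<le> e' \<Longrightarrow> coarse_lift \<gamma> e' \<delta> f"
  unfolding coarse_lift_def by (meson order_trans)

text \<open>The two lifts differ at time \<open>t\<close> by an element of \<open>A\<close> that moves by at most \<open>2 * e\<close> at a small scale, as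
  each lift contributes \<open>e\<close>; by \<open>ultrametric_chain\<close> it stays within \<open>2 * e\<close> of its initial value.\<close>
lemma coarse_lift_rigid:
  assumes f: "coarse_lift \<gamma> e \<delta> f" and g: "coarse_lift \<gamma> e \<delta>' g" and t: "t \<in> {0..1}"
  shows "mdist X (f t) (g t) \<le> max (mdist X (f 0) (g 0)) (2 * e)"
proof -
  have fX: "f s \<in> mspace X" and gX: "g s \<in> mspace X" if "s \<in> {0..1}" for s
    using f g that by (auto simp: coarse_lift_def)
  have "\<exists>a\<in>carrier A. g s = act a (f s)" if "s \<in> {0..1}" for s
    using fibre[of "f s" "g s"] f g that by (simp add: coarse_lift_def)
  then obtain b where b: "\<And>s. s \<in> {0..1} \<Longrightarrow> b s \<in> carrier A"
    and gb: "\<And>s. s \<in> {0..1} \<Longrightarrow> g s = act (b s) (f s)" by metis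
  have fb: "mdist X (f s) (g s) = mdist C \<one>\<^bsub>A\<^esub> (b s)" if "s \<in> {0..1}" for s
    using act_displacement[OF one_closed b[OF that] fX[OF that]] gb[OF that] act_one[OF fX[OF that]]
    by simp
  have "mdist C (b 0) (b t) \<le> 2 * e"
  proof (rule ultrametric_chain[OF ultrametric])
    show "b s \<in> mspace C" if "s \<in> {0..1}" for s using b[OF that] carrier_eq by simp
    show "0 < min \<delta> \<delta>'" using f g by (simp add: coarse_lift_def)
    show "mdist C (b s) (b t) \<le> 2 * e"
      if st: "s \<in> {0..1}" "t \<in> {0..1}" and d: "\<bar>s - t\<bar> < min \<delta> \<delta>'" for s t
    proof -
      have "mdist C (b s) (b t) = mdist X (act (b s) (f s)) (act (b t) (f s))"
        using act_displacement b fX st by simp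
      also have "\<dots> \<le> mdist X (g s) (g t) + mdist X (act (b t) (f t)) (act (b t) (f s))"
        using mdist_triangle[of "g s" X "g t" "act (b t) (f s)"] gb st b fX gX act_closed by simp
      also have "mdist X (act (b t) (f t)) (act (b t) (f s)) = mdist X (f s) (f t)"
        using act_isometry b fX st by (simp add: mdist_commute)
      also have "mdist X (g s) (g t) + mdist X (f s) (f t) \<le> 2 * e"
        using f g st d unfolding coarse_lift_def by (smt (verit))
      finally show ?thesis .
    qed
  qed (use t in auto)
  moreover have "mdist C \<one>\<^bsub>A\<^esub> (b t) \<le> max (mdist C \<one>\<^bsub>A\<^esub> (b 0)) (mdist C (b 0) (b t))"
    using ultrametric one_closed b t carrier_eq unfolding ultrametric_def by auto
  ultimately show ?thesis using fb t by auto
qed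

text \<open>On a fine enough grid the lift is chosen successively, each point near the previous one; off the
  grid it is chosen near the value at the last grid point. Each of the three jumps involved in
  comparing two nearby times costs at most \<open>e / 3\<close>.\<close>
lemma coarse_lift_exists:
  assumes \<gamma>: "pathin (mtopology_of Y) \<gamma>" and x: "x \<in> mspace X" "proj x = \<gamma> 0" and e: "0 < e"
  shows "\<exists>f \<delta>. f 0 = x \<and> coarse_lift \<gamma> e \<delta> f"
proof -
  have \<gamma>Y: "\<gamma> t \<in> mspace Y" if "t \<in> {0..1}" for t
    using path_image_subset_topspace[OF \<gamma>] that by auto
  have L0: "0 < L" using L_ge_1 by simp
  then have "0 < e / (3 * L)" using e by simp
  then obtain \<delta> where \<delta>: "0 < \<delta>" and
    cont: "\<And>s t. s \<in> {0..1} \<Longrightarrow> t \<in> {0..1} \<Longrightarrow> dist s t < \<delta> \<Longrightarrow> mdist Y (\<gamma> s) (\<gamma> t) < e / (3 * L)"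
    using compact_imp_uniformly_continuous_mdist[of "{0..1::real}" Y \<gamma>] \<gamma>
    unfolding pathin_def by (metis compact_Icc)
  obtain n :: nat where n: "0 < n" "inverse (real n) < \<delta>"
    using ex_inverse_of_nat_less[OF \<delta>] by blast
  \<comment> \<open>Truncation at \<open>1\<close> lets the recursion that chooses the lifts run over all natural numbers.\<close>
  define T where "T k = min 1 (real k / real n)" for k
  have T: "T k \<in> {0..1}" for k by (simp add: T_def)
  have T_step: "\<bar>T k - T (Suc k)\<bar> < \<delta>" for k
  proof -
    have "real (Suc k) / real n = real k / real n + inverse (real n)"
      by (simp add: add_divide_distrib inverse_eq_divide)
    moreover have "0 \<le> inverse (real n)" by simp
    ultimately show ?thesis using n unfolding T_def by linarith
  qed
  have "\<exists>u. \<forall>k. (u k \<in> mspace X \<and> proj (u k) = \<gamma> (T k) \<and> (k = 0 \<longrightarrow> u k = x)) \<and>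
      mdist X (u k) (u (Suc k)) \<le> L * mdist Y (\<gamma> (T k)) (\<gamma> (T (Suc k)))"
  proof (rule dependent_nat_choice)
    show "\<exists>u. u \<in> mspace X \<and> proj u = \<gamma> (T 0) \<and> ((0::nat) = 0 \<longrightarrow> u = x)"
      using x by (simp add: T_def)
    show "\<exists>v. (v \<in> mspace X \<and> proj v = \<gamma> (T (Suc k)) \<and> (Suc k = 0 \<longrightarrow> v = x)) \<and>
        mdist X u v \<le> L * mdist Y (\<gamma> (T k)) (\<gamma> (T (Suc k)))"
      if "u \<in> mspace X \<and> proj u = \<gamma> (T k) \<and> (k = 0 \<longrightarrow> u = x)" for u k
      using proj_lift[of u "\<gamma> (T (Suc k))"] \<gamma>Y[OF T] that by auto
  qed
  then obtain u where u: "\<And>k. u k \<in> mspace X" "\<And>k. proj (u k) = \<gamma> (T k)" "u 0 = x"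
    "\<And>k. mdist X (u k) (u (Suc k)) \<le> L * mdist Y (\<gamma> (T k)) (\<gamma> (T (Suc k)))" by auto
  define m where "m t = nat \<lfloor>t * real n\<rfloor>" for t
  have "\<exists>v\<in>mspace X. proj v = \<gamma> t \<and> mdist X (u (m t)) v \<le> L * mdist Y (\<gamma> (T (m t))) (\<gamma> t)"
    if "t \<in> {0..1}" for t
    using proj_lift[OF u(1) \<gamma>Y[OF that]] u(2) by metis
  then obtain f where f: "\<And>t. t \<in> {0..1} \<Longrightarrow> f t \<in> mspace X" "\<And>t. t \<in> {0..1} \<Longrightarrow> proj (f t) = \<gamma> t"
    "\<And>t. t \<in> {0..1} \<Longrightarrow> mdist X (u (m t)) (f t) \<le> L * mdist Y (\<gamma> (T (m t))) (\<gamma> t)" by metis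
  have small: "L * mdist Y (\<gamma> s) (\<gamma> t) \<le> e / 3" if "s \<in> {0..1}" "t \<in> {0..1}" "\<bar>s - t\<bar> < \<delta>" for s t
  proof -
    have "L * mdist Y (\<gamma> s) (\<gamma> t) \<le> L * (e / (3 * L))"
      using cont[OF that(1,2)] that(3) L0 by (intro mult_left_mono) (auto simp: dist_real_def)
    then show ?thesis using L0 by simp
  qed
  have m_le: "real (m t) \<le> t * n" and m_gt: "t * n < real (m t) + 1" if "t \<in> {0..1}" for t
    using that by (simp_all add: m_def)
  have near: "\<bar>T (m t) - t\<bar> < \<delta>" if "t \<in> {0..1}" for t
  proof -
    have "real (m t) / n \<le> t" "t < real (m t) / n + inverse (real n)"
      using m_le[OF that] m_gt[OF that] n by (auto simp: field_simps)
    then show ?thesis using n that unfolding T_def by auto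
  qed
  have uf: "mdist X (u (m t)) (f t) \<le> e / 3" if "t \<in> {0..1}" for t
    using f(3)[OF that] small[OF T that near[OF that]] by linarith
  have uu: "mdist X (u (m s)) (u (m t)) \<le> e / 3"
    if "s \<in> {0..1}" "t \<in> {0..1}" "s \<le> t" "t - s < inverse (real n)" for s t
  proof -
    have "(t - s) * n < 1" using that(4) n by (simp add: field_simps)
    moreover have "s * n \<le> t * n" using that n by simp
    moreover have "(t - s) * n = t * n - s * n" by (simp add: algebra_simps)
    ultimately have "m t = m s \<or> m t = Suc (m s)"
      using m_le[OF that(1)] m_gt[OF that(1)] m_le[OF that(2)] m_gt[OF that(2)] by linarith
    moreover have "mdist X (u (m s)) (u (Suc (m s))) \<le> e / 3"
      using u(4) small[OF T T T_step] order_trans by blast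
    ultimately show ?thesis using e u(1) by (elim disjE) simp_all
  qed
  have "mdist X (f s) (f t) \<le> e" if "s \<in> {0..1}" "t \<in> {0..1}" "\<bar>s - t\<bar> < inverse (real n)" for s t
  proof -
    have "mdist X (u (m s)) (u (m t)) \<le> e / 3"
      using uu[of s t] uu[of t s] that by (cases "s \<le> t") (auto simp: mdist_commute)
    moreover have "mdist X (f s) (f t) \<le> mdist X (f s) (u (m s)) + mdist X (u (m s)) (f t)"
      using mdist_triangle f u that by metis
    moreover have "mdist X (u (m s)) (f t) \<le> mdist X (u (m s)) (u (m t)) + mdist X (u (m t)) (f t)"
      using mdist_triangle f u that by metis
    ultimately show ?thesis using uf[OF that(1)] uf[OF that(2)] by (simp add: mdist_commute)
  qed
  then have "coarse_lift \<gamma> e (inverse (real n)) f"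
    using f n by (auto simp: coarse_lift_def)
  \<comment> \<open>Time \<open>0\<close> is a grid point, so the choice made there is at distance at most \<open>0\<close> from \<open>x\<close>.\<close>
  moreover have "f 0 = x"
  proof -
    have "mdist X x (f 0) \<le> 0"
      using f(3)[of 0] \<gamma>Y[of 0] by (simp add: m_def u T_def)
    then show ?thesis using f(1)[of 0] x by simp
  qed
  ultimately show ?thesis by blast
qed

text \<open>Coarse lifts with oscillation tending to \<open>0\<close> are uniformly Cauchy by rigidity, although they are
  chosen independently of each other.\<close>
lemma path_lifting:
  assumes \<gamma>: "pathin (mtopology_of Y) \<gamma>" and x: "x \<in> mspace X" "proj x = \<gamma> 0"
  obtains f where "pathin (mtopology_of X) f" "f 0 = x" "\<And>t. t \<in> {0..1} \<Longrightarrow> proj (f t) = \<gamma> t"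
proof -
  define e where "e k = inverse (real (Suc k))" for k
  have e0: "0 < e k" for k by (simp add: e_def)
  have e_mono: "e k \<le> e j" if "j \<le> k" for j k using that by (simp add: e_def)
  have e_lim: "e \<longlonglongrightarrow> 0"
    unfolding e_def by (rule LIMSEQ_inverse_real_of_nat)
  have "\<exists>f \<delta>. f 0 = x \<and> coarse_lift \<gamma> (e k) \<delta> f" for k
    using coarse_lift_exists[OF \<gamma> x e0] .
  then obtain F \<delta> where F0: "\<And>k. F k 0 = x" and F: "\<And>k. coarse_lift \<gamma> (e k) (\<delta> k) (F k)"
    by metis
  have FX: "F k t \<in> mspace X" and F\<gamma>: "proj (F k t) = \<gamma> t" if "t \<in> {0..1}" for k t
    using F[of k] that by (auto simp: coarse_lift_def)
  have cauchy: "mdist X (F j t) (F k t) \<le> 2 * e N" if "t \<in> {0..1}" "N \<le> j" "N \<le> k" for j k N t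
    using coarse_lift_rigid[OF coarse_lift_mono[OF F e_mono[OF that(2)]]
        coarse_lift_mono[OF F e_mono[OF that(3)]] that(1)] F0 x e0[of N] by simp
  have "\<exists>y\<in>mspace X. (\<lambda>k. mdist X (F k t) y) \<longlonglongrightarrow> 0" if t: "t \<in> {0..1}" for t
  proof (rule mcomplete_of_limit[OF complete FX[OF t]])
    fix r :: real assume "0 < r"
    then obtain N where "e N < r / 2"
      using order_tendstoD(2)[OF e_lim, of "r / 2"] eventually_sequentially by fastforce
    then show "\<exists>N. \<forall>j\<ge>N. \<forall>k\<ge>N. mdist X (F j t) (F k t) < r"
      using cauchy[OF t, of N] by (intro exI[of _ N] allI impI) (smt (verit) field_sum_of_halves)
  qed
  then obtain f where fX: "\<And>t. t \<in> {0..1} \<Longrightarrow> f t \<in> mspace X"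
    and lim: "\<And>t. t \<in> {0..1} \<Longrightarrow> (\<lambda>k. mdist X (F k t) (f t)) \<longlonglongrightarrow> 0" by metis
  have Ff: "mdist X (F k t) (f t) \<le> 2 * e k" if t: "t \<in> {0..1}" for k t
  proof (rule tendsto_lowerbound)
    show "(\<lambda>j. 2 * e k + mdist X (F j t) (f t)) \<longlonglongrightarrow> 2 * e k"
      using tendsto_add[OF tendsto_const lim[OF t]] by simp
    have "mdist X (F k t) (f t) \<le> 2 * e k + mdist X (F j t) (f t)" if "k \<le> j" for j
      using mdist_triangle[OF FX[OF t] FX[OF t] fX[OF t], of k j] cauchy[OF t order_refl that]
      by linarith
    then show "\<forall>\<^sub>F j in sequentially. mdist X (F k t) (f t) \<le> 2 * e k + mdist X (F j t) (f t)"
      using eventually_sequentially by blast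
  qed simp
  have proj_f: "proj (f t) = \<gamma> t" if t: "t \<in> {0..1}" for t
  proof -
    have "mdist Y (\<gamma> t) (proj (f t)) \<le> L * mdist X (F k t) (f t)" for k
      using proj_lipschitz[OF FX fX, of t t k] F\<gamma> t by simp
    moreover have "(\<lambda>k. L * mdist X (F k t) (f t)) \<longlonglongrightarrow> 0"
      using tendsto_mult_left[OF lim[OF t], of L] by simp
    ultimately have "mdist Y (\<gamma> t) (proj (f t)) \<le> 0"
      using tendsto_lowerbound by fastforce
    then show ?thesis
      using proj_closed[OF fX[OF t]] proj_closed[OF FX[OF t]] F\<gamma>[OF t]
      by simp
  qed
  have "pathin (mtopology_of X) f"
  proof (rule pathinI_mdist[OF fX])
    fix r :: real assume "0 < r"
    then obtain k where k: "e k < r / 5"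
      using order_tendstoD(2)[OF e_lim, of "r / 5"] eventually_sequentially by fastforce
    have "mdist X (f s) (f t) < r" if "s \<in> {0..1}" "t \<in> {0..1}" "\<bar>s - t\<bar> < \<delta> k" for s t
    proof -
      have "mdist X (F k s) (F k t) \<le> e k"
        using F[of k] that by (auto simp: coarse_lift_def)
      moreover have "mdist X (f s) (f t) \<le> mdist X (F k s) (f s) + mdist X (F k s) (f t)"
        using mdist_triangle[OF fX FX fX, of s s t k] that by (simp add: mdist_commute)
      moreover have "mdist X (F k s) (f t) \<le> mdist X (F k s) (F k t) + mdist X (F k t) (f t)"
        using mdist_triangle[OF FX FX fX] that by simp
      ultimately show ?thesis using Ff[OF that(1), of k] Ff[OF that(2), of k] k by linarith
    qed
    moreover have "0 < \<delta> k" using F[of k] by (simp add: coarse_lift_def)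
    ultimately show "\<exists>\<delta>>0. \<forall>s\<in>{0..1}. \<forall>t\<in>{0..1}. \<bar>s - t\<bar> < \<delta> \<longrightarrow> mdist X (f s) (f t) < r"
      by blast
  qed
  moreover have "f 0 = x"
    using lim[of 0] F0 fX[of 0] x by (simp add: LIMSEQ_const_iff)
  ultimately show thesis using that proj_f by blast
qed

definition lift :: "'x \<Rightarrow> (real \<Rightarrow> 'y) \<Rightarrow> (real \<Rightarrow> 'x) \<Rightarrow> bool" where
  "lift x \<gamma> f \<longleftrightarrow> pathin (mtopology_of X) f \<and> f 0 = x \<and> (\<forall>t\<in>{0..1}. proj (f t) = \<gamma> t)"

lemma lift_in_mspace: "lift x \<gamma> f \<Longrightarrow> t \<in> {0..1} \<Longrightarrow> f t \<in> mspace X"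
  using path_image_subset_topspace[of "mtopology_of X" f] by (auto simp: lift_def)

lemma lift_imp_coarse_lift:
  assumes "lift x \<gamma> f" "0 < e"
  obtains \<delta> where "coarse_lift \<gamma> e \<delta> f"
proof -
  obtain \<delta> where "0 < \<delta>"
    "\<And>s t. s \<in> {0..1} \<Longrightarrow> t \<in> {0..1} \<Longrightarrow> dist s t < \<delta> \<Longrightarrow> mdist X (f s) (f t) < e"
    using compact_imp_uniformly_continuous_mdist[of "{0..1::real}" X f e] assms
    unfolding lift_def pathin_def by (metis compact_Icc)
  then have "coarse_lift \<gamma> e \<delta> f"
    using assms(1) lift_in_mspace[OF assms(1)]
    by (auto simp: coarse_lift_def lift_def dist_real_def intro: less_imp_le)
  then show thesis by (rule that)
qed

text \<open>Move the lift \<open>f\<close> pointwise into the fibres over \<open>\<gamma>'\<close>, at cost \<open>L * e\<close>. The result \<open>h\<close> is not continuous,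
  but it is a coarse lift of \<open>\<gamma>'\<close> with oscillation \<open>3 * L * e\<close>, so it is rigidly tied to \<open>g\<close> within
  \<open>6 * L * e\<close>.\<close>
lemma lift_stable:
  assumes f: "lift x \<gamma> f" and g: "lift x \<gamma>' g" and "0 < e"
    and near: "\<And>t. t \<in> {0..1} \<Longrightarrow> mdist Y (\<gamma> t) (\<gamma>' t) \<le> e" and t: "t \<in> {0..1}"
  shows "mdist X (f t) (g t) \<le> 7 * L * e"
proof -
  have "L > 0" using L_ge_1 by simp
  have fX: "f s \<in> mspace X" and gX: "g s \<in> mspace X" and f\<gamma>: "proj (f s) = \<gamma> s"
    and g\<gamma>: "proj (g s) = \<gamma>' s" if "s \<in> {0..1}" for s
    using f g lift_in_mspace that by (auto simp: lift_def)
  have "\<exists>v\<in>mspace X. proj v = \<gamma>' s \<and> mdist X (f s) v \<le> L * e" if s: "s \<in> {0..1}" for s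
  proof -
    obtain v where "v \<in> mspace X" "proj v = \<gamma>' s" "mdist X (f s) v \<le> L * mdist Y (\<gamma> s) (\<gamma>' s)"
      using proj_lift[OF fX[OF s], of "\<gamma>' s"] proj_closed[OF gX[OF s]] f\<gamma>[OF s] g\<gamma>[OF s] by auto
    moreover have "L * mdist Y (\<gamma> s) (\<gamma>' s) \<le> L * e"
      using near[OF s] \<open>0 < L\<close> by simp
    ultimately show ?thesis by (meson order_trans)
  qed
  then obtain h where h: "\<And>s. s \<in> {0..1} \<Longrightarrow> h s \<in> mspace X" "\<And>s. s \<in> {0..1} \<Longrightarrow> proj (h s) = \<gamma>' s"
    and fh: "\<And>s. s \<in> {0..1} \<Longrightarrow> mdist X (f s) (h s) \<le> L * e" by metis
  obtain \<delta> where \<delta>: "coarse_lift \<gamma> (L * e) \<delta> f"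
    using lift_imp_coarse_lift[OF f] \<open>0 < e\<close> \<open>0 < L\<close> by (metis mult_pos_pos)
  have "coarse_lift \<gamma>' (3 * L * e) \<delta> h"
    unfolding coarse_lift_def
  proof (intro conjI ballI impI)
    show "0 < \<delta>" using \<delta> by (simp add: coarse_lift_def)
    fix s t assume st: "s \<in> {0..1}" "t \<in> {0..1}" "\<bar>s - t\<bar> < \<delta>"
    have "mdist X (f s) (f t) \<le> L * e" using \<delta> st by (simp add: coarse_lift_def)
    moreover have "mdist X (h s) (h t) \<le> mdist X (f s) (h s) + mdist X (f s) (h t)"
      using mdist_triangle[OF h(1) fX h(1), of s s t] st by (simp add: mdist_commute)
    moreover have "mdist X (f s) (h t) \<le> mdist X (f s) (f t) + mdist X (f t) (h t)"
      using mdist_triangle[OF fX fX h(1)] st by simp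
    ultimately show "mdist X (h s) (h t) \<le> 3 * L * e"
      using fh[OF st(1)] fh[OF st(2)] by (simp add: mdist_commute)
  qed (use h in auto)
  moreover obtain \<delta>' where "coarse_lift \<gamma>' (3 * L * e) \<delta>' g"
    using lift_imp_coarse_lift[OF g, of "3 * L * e"] \<open>0 < e\<close> \<open>0 < L\<close> by auto
  ultimately have "mdist X (h t) (g t) \<le> max (mdist X (h 0) (g 0)) (2 * (3 * L * e))"
    using coarse_lift_rigid t by blast
  moreover have "f 0 = g 0" using f g by (simp add: lift_def)
  then have "mdist X (h 0) (g 0) \<le> L * e"
    using fh[of 0] by (simp add: mdist_commute)
  moreover have "mdist X (f t) (g t) \<le> mdist X (f t) (h t) + mdist X (h t) (g t)"
    using mdist_triangle[OF fX h(1) gX] t by simp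
  moreover have "0 < L * e" using \<open>0 < e\<close> \<open>0 < L\<close> by simp
  ultimately show ?thesis using fh[OF t] by simp
qed

text \<open>The stability estimate holds for every positive \<open>e\<close> if both lifts are over the same path. With
  \<open>d\<close> the distance of the two values, \<open>e = d / (14 * L)\<close> yields \<open>d \<le> d / 2\<close>.\<close>
lemma lift_unique:
  assumes f: "lift x \<gamma> f" and g: "lift x \<gamma> g" and t: "t \<in> {0..1}"
  shows "f t = g t"
proof (rule ccontr)
  assume "f t \<noteq> g t"
  have fX: "f s \<in> mspace X" and gX: "g s \<in> mspace X" if "s \<in> {0..1}" for s
    using f g lift_in_mspace that by auto
  have L: "0 < L" using L_ge_1 by simp
  let ?d = "mdist X (f t) (g t)"
  have "0 < ?d" using \<open>f t \<noteq> g t\<close> fX[OF t] gX[OF t] by (metis mdist_zero mdist_nonneg order_less_le)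
  moreover have "mdist Y (\<gamma> s) (\<gamma> s) \<le> ?d / (14 * L)" if "s \<in> {0..1}" for s
  proof -
    have "\<gamma> s \<in> mspace Y" using f proj_closed[OF fX[OF that]] that by (simp add: lift_def)
    then show ?thesis using L by simp
  qed
  ultimately have "?d \<le> 7 * L * (?d / (14 * L))"
    using L by (intro lift_stable[OF f g _ _ t]) auto
  also have "\<dots> = ?d / 2" using L by simp
  finally show False using \<open>0 < ?d\<close> by simp
qed

definition monodromy :: "'x \<Rightarrow> (real \<Rightarrow> 'y) \<Rightarrow> 'c" where
  "monodromy x \<gamma> = (THE a. a \<in> carrier A \<and> (\<exists>f. lift x \<gamma> f \<and> f 1 = act a x))"

lemma act_eq_iff:
  assumes "a \<in> carrier A" "b \<in> carrier A" "x \<in> mspace X"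
  shows "act a x = act b x \<longleftrightarrow> a = b"
  using act_displacement[OF assms] assms act_closed[OF _ assms(3)] carrier_eq
  by (metis mdist_zero)

lemma monodromy_eqI:
  assumes "lift x \<gamma> f" "f 1 = act a x" "a \<in> carrier A" "x \<in> mspace X"
  shows "monodromy x \<gamma> = a"
  unfolding monodromy_def
proof (rule the_equality)
  fix b assume "b \<in> carrier A \<and> (\<exists>g. lift x \<gamma> g \<and> g 1 = act b x)"
  then show "b = a"
    using lift_unique[OF _ assms(1)] assms(2-4) act_eq_iff[of b a x] by fastforce
qed (use assms in blast)

lemma monodromy_lift:
  assumes \<gamma>: "\<gamma> \<in> loops (mtopology_of Y) (proj x)" and x: "x \<in> mspace X"
  obtains f where "lift x \<gamma> f" "f 1 = act (monodromy x \<gamma>) x" "monodromy x \<gamma> \<in> carrier A"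
proof -
  have "pathin (mtopology_of Y) \<gamma>" "proj x = \<gamma> 0" using \<gamma> by (auto simp: loops_def)
  then obtain f where f: "lift x \<gamma> f"
    using path_lifting[OF _ x] unfolding lift_def by metis
  then have "proj x = proj (f 1)" using \<gamma> by (simp add: lift_def loops_def)
  then obtain a where "a \<in> carrier A" "f 1 = act a x"
    using fibre[OF x lift_in_mspace[OF f, of 1]] by auto
  then show thesis using that[OF f] monodromy_eqI[OF f _ _ x] by simp
qed

text \<open>A lift of the second loop that starts where the lift of the first one ends is the translate of
  the lift that starts at \<open>x\<close>.\<close>
lemma monodromy_join:
  assumes \<gamma>: "\<gamma> \<in> loops (mtopology_of Y) (proj x)" and \<gamma>': "\<gamma>' \<in> loops (mtopology_of Y) (proj x)"
    and x: "x \<in> mspace X"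
  shows "join_loops \<gamma> \<gamma>' \<in> loops (mtopology_of Y) (proj x)"
    and "monodromy x (join_loops \<gamma> \<gamma>') = monodromy x \<gamma> \<otimes>\<^bsub>A\<^esub> monodromy x \<gamma>'"
proof -
  let ?a = "monodromy x \<gamma>" and ?b = "monodromy x \<gamma>'"
  obtain f where f: "lift x \<gamma> f" "f 1 = act ?a x" and a: "?a \<in> carrier A"
    using monodromy_lift[OF \<gamma> x] .
  obtain g where g: "lift x \<gamma>' g" "g 1 = act ?b x" and b: "?b \<in> carrier A"
    using monodromy_lift[OF \<gamma>' x] .
  let ?g = "\<lambda>t. act ?a (g t)"
  have "pathin (mtopology_of X) ?g"
  proof (rule pathinI_mdist)
    show "?g t \<in> mspace X" if "t \<in> {0..1}" for t using act_closed[OF a lift_in_mspace[OF g(1) that]] .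
    fix e :: real assume "0 < e"
    then have "0 < e / 2" by simp
    then obtain \<delta> where "coarse_lift \<gamma>' (e / 2) \<delta> g" using lift_imp_coarse_lift[OF g(1)] by blast
    then show "\<exists>\<delta>>0. \<forall>s\<in>{0..1}. \<forall>t\<in>{0..1}. \<bar>s - t\<bar> < \<delta> \<longrightarrow> mdist X (?g s) (?g t) < e"
      using \<open>0 < e\<close> act_isometry[OF a]
      by (intro exI[of _ \<delta>]) (force simp: coarse_lift_def)
  qed
  then have "pathin (mtopology_of X) (join_loops f ?g)"
    using f g act_one x by (intro pathin_join_loops) (auto simp: lift_def)
  moreover have "proj (join_loops f ?g t) = join_loops \<gamma> \<gamma>' t" if "t \<in> {0..1}" for t
  proof (cases "t \<le> 1/2")
    case True
    then show ?thesis using that f(1) by (simp add: join_loops_def lift_def)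
  next
    case False
    then have "2 * t - 1 \<in> {0..1}" using that by auto
    then show ?thesis
      using False g(1) proj_act[OF a lift_in_mspace[OF g(1)]] by (simp add: join_loops_def lift_def)
  qed
  ultimately have "lift x (join_loops \<gamma> \<gamma>') (join_loops f ?g)"
    using f(1) by (auto simp: lift_def join_loops_def)
  moreover have "join_loops f ?g 1 = act (?a \<otimes>\<^bsub>A\<^esub> ?b) x"
    using g(2) act_mult[OF a b x] by (simp add: join_loops_def)
  ultimately show "monodromy x (join_loops \<gamma> \<gamma>') = ?a \<otimes>\<^bsub>A\<^esub> ?b"
    using monodromy_eqI mult_closed[OF a b] x by blast
  show "join_loops \<gamma> \<gamma>' \<in> loops (mtopology_of Y) (proj x)"
    using \<gamma> \<gamma>' pathin_join_loops[of "mtopology_of Y" \<gamma> \<gamma>'] by (auto simp: loops_def join_loops_def)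
qed

lemma continuous_map_proj: "continuous_map (mtopology_of X) (mtopology_of Y) proj"
proof (rule Lipschitz_continuous_imp_continuous_map)
  show "Lipschitz_continuous_map X Y proj"
    unfolding Lipschitz_continuous_map_def using proj_closed proj_lipschitz by blast
qed

lemma proj_path_in_loops:
  assumes "pathin (mtopology_of X) f" "f 0 = x" "f 1 = act a x" "a \<in> carrier A" "x \<in> mspace X"
  shows "proj \<circ> f \<in> loops (mtopology_of Y) (proj x)" "lift x (proj \<circ> f) f"
    "monodromy x (proj \<circ> f) = a"
proof -
  show l: "lift x (proj \<circ> f) f" using assms by (simp add: lift_def)
  show "proj \<circ> f \<in> loops (mtopology_of Y) (proj x)"
    using pathin_compose[OF assms(1) continuous_map_proj] assms proj_act by (simp add: loops_def)
  show "monodromy x (proj \<circ> f) = a" using monodromy_eqI[OF l] assms by simp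
qed

text \<open>Uniform continuity of the homotopy and stability of lifts bound the change of the monodromy at
  small scale by any given \<open>e\<close>; the ultrametric inequality turns this into a bound by \<open>e\<close> from one end
  of the homotopy to the other.\<close>
lemma monodromy_homotopy_invariant:
  assumes h: "(\<gamma>, \<gamma>') \<in> loop_homotopy (mtopology_of Y) (proj x)" and x: "x \<in> mspace X"
  shows "monodromy x \<gamma> = monodromy x \<gamma>'"
proof -
  have "homotopic_with (\<lambda>r. r 0 = proj x \<and> r 1 = proj x) (top_of_set {0..1}) (mtopology_of Y) \<gamma> \<gamma>'"
    using assms(1) by (simp add: loop_homotopy_def)
  then obtain h :: "real \<times> real \<Rightarrow> _" where h: "continuous_map (prod_topology (top_of_set {0..1}) (top_of_set {0..1})) (mtopology_of Y) h"
    and h0: "\<And>t. h (0, t) = \<gamma> t" and h1: "\<And>t. h (1, t) = \<gamma>' t"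
    and hx: "\<And>s. s \<in> {0..1} \<Longrightarrow> h (s, 0) = proj x \<and> h (s, 1) = proj x"
    unfolding homotopic_with_def by blast
  have h': "continuous_map (top_of_set ({0..1} \<times> {0..1})) (mtopology_of Y) h"
    using h by (simp add: prod_topology_subtopology_eu)
  have H: "(\<lambda>t. h (s, t)) \<in> loops (mtopology_of Y) (proj x)" if "s \<in> {0..1}" for s
  proof -
    have "pathin (mtopology_of Y) (\<lambda>t. h (s, t))"
      unfolding pathin_def
      by (rule continuous_map_compose[where g = h and f = "\<lambda>t. (s, t)", unfolded o_def])
        (use h that in \<open>auto simp: continuous_map_in_subtopology intro!: continuous_intros\<close>)
    then show ?thesis using hx[OF that] by (simp add: loops_def)
  qed
  define b where "b s = monodromy x (\<lambda>t. h (s, t))" for s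
  have b: "b s \<in> carrier A" if "s \<in> {0..1}" for s
    unfolding b_def using monodromy_lift[OF H[OF that] x] by blast
  have L: "0 < L" using L_ge_1 by simp
  have "mdist C (b 0) (b 1) \<le> e" if "0 < e" for e
  proof -
    have e: "0 < e / (7 * L)" using that L by simp
    obtain \<delta> where "0 < \<delta>" and \<delta>: "\<And>u v. u \<in> {0..1} \<times> {0..1} \<Longrightarrow> v \<in> {0..1} \<times> {0..1} \<Longrightarrow>
        dist u v < \<delta> \<Longrightarrow> mdist Y (h u) (h v) < e / (7 * L)"
      using compact_imp_uniformly_continuous_mdist[OF _ h' e] compact_Times[OF compact_Icc compact_Icc]
      by metis
    show ?thesis
    proof (rule ultrametric_chain[OF ultrametric _ \<open>0 < \<delta>\<close>])
      show "b s \<in> mspace C" if "s \<in> {0..1}" for s using b[OF that] carrier_eq by simp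
      show "mdist C (b s) (b s') \<le> e" if s: "s \<in> {0..1}" "s' \<in> {0..1}" "\<bar>s - s'\<bar> < \<delta>" for s s'
      proof -
        obtain f where f: "lift x (\<lambda>t. h (s, t)) f" "f 1 = act (b s) x"
          unfolding b_def using monodromy_lift[OF H[OF s(1)] x] by blast
        obtain g where g: "lift x (\<lambda>t. h (s', t)) g" "g 1 = act (b s') x"
          unfolding b_def using monodromy_lift[OF H[OF s(2)] x] by blast
        have "mdist Y (h (s, t)) (h (s', t)) \<le> e / (7 * L)" if "t \<in> {0..1}" for t
          using \<delta>[of "(s, t)" "(s', t)"] s that by (simp add: dist_Pair_Pair dist_real_def)
        from lift_stable[OF f(1) g(1) e this, of 1]
        have "mdist X (f 1) (g 1) \<le> e" using L by simp
        then show ?thesis using act_displacement[OF b[OF s(1)] b[OF s(2)] x] f g by simp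
      qed
    qed simp
  qed
  then have "mdist C (b 0) (b 1) \<le> 0" by (rule field_le_epsilon[of _ 0, simplified])
  then have "b 0 = b 1" using b[of 0] b[of 1] carrier_eq by simp
  then show ?thesis by (simp add: b_def h0 h1)
qed

lemma monodromy_eq_imp_homotopic:
  assumes sc: "simply_connected_space (mtopology_of X)" and x: "x \<in> mspace X"
    and \<gamma>: "\<gamma> \<in> loops (mtopology_of Y) (proj x)" and \<gamma>': "\<gamma>' \<in> loops (mtopology_of Y) (proj x)"
    and eq: "monodromy x \<gamma> = monodromy x \<gamma>'"
  shows "(\<gamma>, \<gamma>') \<in> loop_homotopy (mtopology_of Y) (proj x)"
proof -
  let ?y = "act (monodromy x \<gamma>) x"
  obtain f where f: "lift x \<gamma> f" "f 1 = ?y" and a: "monodromy x \<gamma> \<in> carrier A"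
    using monodromy_lift[OF \<gamma> x] .
  obtain g where g: "lift x \<gamma>' g" "g 1 = ?y"
    using monodromy_lift[OF \<gamma>' x] eq by metis
  have "homotopic_with (\<lambda>r. r 0 = x \<and> r 1 = ?y) (top_of_set {0..1}) (mtopology_of X) f g"
    using f g by (intro simply_connected_imp_paths_homotopic[OF sc]) (auto simp: lift_def)
  then have "homotopic_with (\<lambda>r. r 0 = proj x \<and> r 1 = proj x) (top_of_set {0..1}) (mtopology_of Y)
      (proj \<circ> f) (proj \<circ> g)"
    by (rule homotopic_with_compose_continuous_map_left)
      (use continuous_map_proj proj_act[OF a x] in auto)
  then have "homotopic_with (\<lambda>r. r 0 = proj x \<and> r 1 = proj x) (top_of_set {0..1}) (mtopology_of Y) \<gamma> \<gamma>'"
    by (rule homotopic_with_eq) (use f g in \<open>auto simp: lift_def\<close>)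
  then show ?thesis using \<gamma> \<gamma>' by (simp add: loop_homotopy_def)
qed

text \<open>Two loops are homotopic exactly if they have the same monodromy. So the elements of the fundamental
  group are the fibres of the monodromy on loops, and concatenation of loops is well defined on them
  because the monodromy is multiplicative.\<close>
theorem fundamental_group_iso:
  assumes sc: "simply_connected_space (mtopology_of X)" and x: "x \<in> mspace X"
  shows "fundamental_group (mtopology_of Y) (proj x) \<cong> A"
proof -
  let ?\<Omega> = "loops (mtopology_of Y) (proj x)" and ?R = "loop_homotopy (mtopology_of Y) (proj x)"
  let ?\<mu> = "monodromy x"
  have R: "?R = {(\<gamma>, \<gamma>'). \<gamma> \<in> ?\<Omega> \<and> \<gamma>' \<in> ?\<Omega> \<and> ?\<mu> \<gamma> = ?\<mu> \<gamma>'}"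
    using monodromy_homotopy_invariant[OF _ x] monodromy_eq_imp_homotopic[OF sc x]
    by (auto simp: loop_homotopy_def)
  have cls: "?R `` {\<gamma>} = {\<gamma>'\<in>?\<Omega>. ?\<mu> \<gamma>' = ?\<mu> \<gamma>}" if "\<gamma> \<in> ?\<Omega>" for \<gamma>
    using that by (auto simp: R)
  have \<mu>_closed: "?\<mu> \<gamma> \<in> carrier A" if "\<gamma> \<in> ?\<Omega>" for \<gamma>
    using monodromy_lift[OF that x] by blast
  have surj: "\<exists>\<gamma>\<in>?\<Omega>. ?\<mu> \<gamma> = a" if a: "a \<in> carrier A" for a
  proof -
    have "path_connected_space (mtopology_of X)" using sc by (simp add: simply_connected_space_def)
    then obtain f where "pathin (mtopology_of X) f" "f 0 = x" "f 1 = act a x"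
      using x act_closed[OF a x] unfolding path_connected_space_def by auto
    from proj_path_in_loops[OF this a x] show ?thesis by blast
  qed
  define \<Phi> where "\<Phi> P = ?\<mu> (SOME \<gamma>. \<gamma> \<in> P)" for P
  have \<Phi>: "\<Phi> (?R `` {\<gamma>}) = ?\<mu> \<gamma>" if "\<gamma> \<in> ?\<Omega>" for \<gamma>
  proof -
    have "(SOME \<gamma>'. \<gamma>' \<in> ?R `` {\<gamma>}) \<in> ?R `` {\<gamma>}"
      by (rule someI[of _ \<gamma>]) (use that cls in simp)
    then show ?thesis unfolding \<Phi>_def using cls[OF that] by simp
  qed
  have carrier: "carrier (fundamental_group (mtopology_of Y) (proj x)) = (\<lambda>\<gamma>. ?R `` {\<gamma>}) ` ?\<Omega>"
    by (auto simp: fundamental_group_def quotient_def)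
  have mult: "?R `` {\<gamma>} \<otimes>\<^bsub>fundamental_group (mtopology_of Y) (proj x)\<^esub> ?R `` {\<gamma>'}
      = ?R `` {join_loops \<gamma> \<gamma>'}" if g: "\<gamma> \<in> ?\<Omega>" "\<gamma>' \<in> ?\<Omega>" for \<gamma> \<gamma>'
  proof -
    have "?R `` {join_loops f g} = ?R `` {join_loops \<gamma> \<gamma>'}"
      if "f \<in> ?R `` {\<gamma>}" "g \<in> ?R `` {\<gamma>'}" for f g
    proof -
      have "f \<in> ?\<Omega>" "g \<in> ?\<Omega>" "?\<mu> f = ?\<mu> \<gamma>" "?\<mu> g = ?\<mu> \<gamma>'" using that cls g by auto
      then show ?thesis using monodromy_join[OF _ _ x] g by (simp add: cls)
    qed
    moreover have "\<gamma> \<in> ?R `` {\<gamma>}" "\<gamma>' \<in> ?R `` {\<gamma>'}" using cls g by auto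
    ultimately show ?thesis
      unfolding fundamental_group_def monoid.simps by (intro UN_UN_constant)
  qed
  have "\<Phi> \<in> iso (fundamental_group (mtopology_of Y) (proj x)) A"
  proof (rule isoI)
    show "\<Phi> \<in> hom (fundamental_group (mtopology_of Y) (proj x)) A"
      by (rule homI) (auto simp: carrier mult \<Phi> \<mu>_closed monodromy_join[OF _ _ x])
    show "bij_betw \<Phi> (carrier (fundamental_group (mtopology_of Y) (proj x))) (carrier A)"
      unfolding bij_betw_def
    proof
      show "inj_on \<Phi> (carrier (fundamental_group (mtopology_of Y) (proj x)))"
      proof (rule inj_onI)
        fix P P' assume "P \<in> carrier (fundamental_group (mtopology_of Y) (proj x))"
          "P' \<in> carrier (fundamental_group (mtopology_of Y) (proj x))" and eq: "\<Phi> P = \<Phi> P'"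
        then obtain \<gamma> \<gamma>' where g: "\<gamma> \<in> ?\<Omega>" "\<gamma>' \<in> ?\<Omega>" "P = ?R `` {\<gamma>}" "P' = ?R `` {\<gamma>'}"
          unfolding carrier by blast
        then have "?\<mu> \<gamma> = ?\<mu> \<gamma>'" using eq \<Phi> by simp
        then show "P = P'" using g cls by simp
      qed
      have im: "\<Phi> ` carrier (fundamental_group (mtopology_of Y) (proj x)) = ?\<mu> ` ?\<Omega>"
        by (force simp: carrier \<Phi> image_image)
      then show "\<Phi> ` carrier (fundamental_group (mtopology_of Y) (proj x)) = carrier A"
        unfolding im using surj \<mu>_closed by fastforce
    qed
  qed
  then show ?thesis by (auto simp: is_iso_def)
qed

end

section \<open>Comparison of word lengths\<close>

lemma (in group) word_length_generator_le:
  assumes S: "S \<subseteq> carrier G" "generate G S = carrier G" and s: "s \<in> S \<union> (\<lambda>s. inv s) ` S"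
  shows "word_length G S s \<le> 1"
proof -
  have "s \<in> carrier G" using symm_subset[OF S] s by blast
  then show ?thesis using word_length_le[OF S, of "[s]" s] s by simp
qed

lemma (in group) word_length_dominated:
  assumes S: "S \<subseteq> carrier G" "generate G S = carrier G"
    and K: "K \<subseteq> carrier G" "generate G K = carrier G"
    and m: "\<And>u. u \<in> K \<Longrightarrow> word_length G S u \<le> m" and g: "g \<in> carrier G"
  shows "word_length G S g \<le> m * word_length G K g"
proof -
  have mK: "word_length G S u \<le> m" "u \<in> carrier G" if "u \<in> K \<union> (\<lambda>s. inv s) ` K" for u
    using that m word_length_inv[OF S] K by auto
  have one: "word_length G S \<one> = 0" using word_length_eq_0_iff[OF S] by simp
  have "set ws \<subseteq> K \<union> (\<lambda>s. inv s) ` K \<Longrightarrow>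
      word_length G S (foldr (\<lambda>x y. x \<otimes> y) ws \<one>) \<le> m * length ws" for ws
  proof (induction ws)
    case (Cons u ws)
    have "set ws \<subseteq> carrier G" using Cons.prems mK by auto
    then have "word_length G S (u \<otimes> foldr (\<lambda>x y. x \<otimes> y) ws \<one>)
        \<le> word_length G S u + word_length G S (foldr (\<lambda>x y. x \<otimes> y) ws \<one>)"
      using word_length_mult_le[OF S mK(2) foldr_mult_closed] Cons.prems by simp
    also have "\<dots> \<le> m + m * length ws" using Cons mK(1) by (intro add_mono) auto
    finally show ?case by simp
  qed (simp add: one)
  with word_length_witness[OF K g] show ?thesis by metis
qed

text \<open>Each ball is the image under multiplication of the product of the previous ball with the compact
  set of letters and \<open>\<one>\<close>.\<close>
lemma (in group) compactin_word_ball: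
  assumes T: "topspace T = carrier G"
    and mult: "continuous_map (prod_topology T T) T (\<lambda>(x, y). x \<otimes> y)"
    and inv: "continuous_map T T (\<lambda>x. inv x)"
    and S: "compactin T S" "generate G S = carrier G"
  shows "compactin T {g \<in> carrier G. word_length G S g \<le> n}"
proof (induction n)
  have S': "S \<subseteq> carrier G" using compactin_subset_topspace[OF S(1)] T by simp
  note S'' = S' S(2)
  {
    case 0
    have "{g \<in> carrier G. word_length G S g \<le> 0} = {\<one>}"
      using word_length_eq_0_iff[OF S''] by auto
    then show ?case using T by simp
  next
    case (Suc n)
    let ?B = "\<lambda>n. {g \<in> carrier G. word_length G S g \<le> n}"
    let ?U = "insert \<one> (S \<union> (\<lambda>s. inv s) ` S)"
    have "?B (Suc n) = (\<lambda>(x, y). x \<otimes> y) ` (?U \<times> ?B n)"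
    proof (intro equalityI subsetI)
      fix g assume "g \<in> ?B (Suc n)"
      then have g: "g \<in> carrier G" "word_length G S g \<le> Suc n" by auto
      obtain ws where ws: "length ws = word_length G S g" "set ws \<subseteq> S \<union> (\<lambda>s. inv s) ` S"
        "foldr (\<lambda>x y. x \<otimes> y) ws \<one> = g" using word_length_witness[OF S'' g(1)] by blast
      show "g \<in> (\<lambda>(x, y). x \<otimes> y) ` (?U \<times> ?B n)"
      proof (cases ws)
        case Nil
        then have "g = \<one>" using ws by simp
        then show ?thesis
          using word_length_eq_0_iff[OF S'', of \<one>] by (intro image_eqI[of _ _ "(\<one>, \<one>)"]) auto
      next
        case (Cons u us)
        let ?h = "foldr (\<lambda>x y. x \<otimes> y) us \<one>"
        have "set us \<subseteq> carrier G" using ws Cons symm_subset[OF S''] by auto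
        then have "?h \<in> ?B n"
          using foldr_mult_closed word_length_le[OF S'', of us] ws g Cons by force
        then show ?thesis using ws Cons by (intro image_eqI[of _ _ "(u, ?h)"]) auto
      qed
    next
      fix g assume "g \<in> (\<lambda>(x, y). x \<otimes> y) ` (?U \<times> ?B n)"
      then obtain u h where uh: "g = u \<otimes> h" "u \<in> ?U" "h \<in> carrier G" "word_length G S h \<le> n"
        by auto
      have "word_length G S u \<le> 1"
        using uh(2) word_length_generator_le[OF S''] word_length_eq_0_iff[OF S'', of \<one>] by auto
      moreover have "u \<in> carrier G" using uh(2) symm_subset[OF S''] by auto
      ultimately show "g \<in> ?B (Suc n)"
        using word_length_mult_le[OF S'', of u h] uh by auto
    qed
    moreover have "compactin T ?U"
    proof -
      have "?U = {\<one>} \<union> (S \<union> (\<lambda>s. inv s) ` S)" by auto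
      moreover have "compactin T {\<one>}" using T by simp
      ultimately show ?thesis
        using image_compactin[OF S(1) inv] S(1) compactin_Un by metis
    qed
    ultimately show ?case
      using Suc.IH by (auto intro!: image_compactin[OF _ mult] simp: compactin_Times)
  }
qed

lemma (in group) inv_cancel_left:
  assumes "a \<in> carrier G" "y \<in> carrier G"
  shows "inv a \<otimes> (a \<otimes> y) = y" "a \<otimes> (inv a \<otimes> y) = y"
  using assms by (simp_all add: m_assoc[symmetric])

text \<open>The balls of the word length of \<open>S\<close> are compact and cover the group, so by Baire category one of
  them has interior. Finitely many translates of this interior cover \<open>K\<close>, which
  bounds the \<open>S\<close>-length on \<open>K\<close>.\<close>
theorem (in group) word_length_comparable:
  assumes G: "locally_compact_group G T"
    and S: "compact_generating_set G T S" and K: "compact_generating_set G T K"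
  shows "\<exists>m. \<forall>g\<in>carrier G. word_length G S g \<le> m * word_length G K g"
proof -
  have T: "topspace T = carrier G"
    and mult: "continuous_map (prod_topology T T) T (\<lambda>(x, y). x \<otimes> y)"
    and inv: "continuous_map T T (\<lambda>x. inv x)"
    and haus: "Hausdorff_space T" and lc: "locally_compact_space T"
    using G by (auto simp: locally_compact_group_def)
  have S': "S \<subseteq> carrier G" "generate G S = carrier G"
    and K': "K \<subseteq> carrier G" "generate G K = carrier G"
    using S K compactin_subset_topspace T by (force simp: compact_generating_set_def)+
  let ?B = "\<lambda>n. {g \<in> carrier G. word_length G S g \<le> n}"
  have compB: "compactin T (?B n)" for n
    using compactin_word_ball[OF T mult inv] S by (simp add: compact_generating_set_def)
  have "\<exists>n. T interior_of ?B n \<noteq> {}"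
  proof (rule ccontr)
    assume "\<not> ?thesis"
    then have "T interior_of \<Union>(range ?B) = {}"
      using lc haus locally_compact_Hausdorff_imp_regular_space compactin_imp_closedin[OF haus compB]
      by (intro Baire_category_alt) auto
    moreover have "\<Union>(range ?B) = topspace T" using T by auto
    moreover have "carrier G \<noteq> {}" using one_closed by blast
    ultimately show False using T interior_of_topspace[of T] by simp
  qed
  then obtain n where "T interior_of ?B n \<noteq> {}" by (rule exE)
  then obtain g where g: "g \<in> T interior_of ?B n" unfolding ex_in_conv[symmetric] by (rule exE)
  let ?V = "T interior_of ?B n"
  have gG: "g \<in> carrier G" using subsetD[OF interior_of_subset g] by simp
  define W where "W k = {x \<in> topspace T. (g \<otimes> inv k) \<otimes> x \<in> ?V}" for k
  have openW: "openin T (W k)" if k: "k \<in> K" for k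
  proof -
    have "g \<otimes> inv k \<in> topspace T" using k K' gG T by auto
    then have "continuous_map T (prod_topology T T) (\<lambda>x. (g \<otimes> inv k, x))"
      by (auto intro!: continuous_intros)
    from continuous_map_compose[OF this mult]
    have "continuous_map T T (\<lambda>x. (g \<otimes> inv k) \<otimes> x)" by (simp add: o_def)
    then show ?thesis unfolding W_def by (rule openin_continuous_map_preimage) simp
  qed
  have kW: "k \<in> W k" if "k \<in> K" for k
    using that K' gG g T by (auto simp: W_def m_assoc)
  have "compactin T K" using K by (simp add: compact_generating_set_def)
  then obtain \<F> where \<F>: "finite \<F>" "\<F> \<subseteq> W ` K" "K \<subseteq> \<Union>\<F>"
    using openW kW unfolding compactin_def by (metis (no_types, lifting) UN_I imageE subsetI)
  then obtain F where F: "finite F" "F \<subseteq> K" "\<F> = W ` F" by (metis finite_subset_image)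
  define m where "m = (\<Sum>k\<in>F. word_length G S k) + word_length G S g + n"
  have "word_length G S x \<le> m" if x: "x \<in> K" for x
  proof -
    obtain k where k: "k \<in> F" "x \<in> W k" using \<F> F x by blast
    have c: "k \<in> carrier G" "x \<in> carrier G" using k F K' x by auto
    let ?y = "(g \<otimes> inv k) \<otimes> x"
    have y: "?y \<in> carrier G" "word_length G S ?y \<le> n"
      using subsetD[OF interior_of_subset[of T "?B n"], of ?y] k(2) by (simp_all add: W_def)
    have "x = (k \<otimes> inv g) \<otimes> ?y"
      using c gG by (simp add: m_assoc inv_cancel_left)
    then have "word_length G S x \<le> word_length G S (k \<otimes> inv g) + word_length G S ?y"
      using word_length_mult_le[OF S', of "k \<otimes> inv g" ?y] c gG y by simp
    moreover have "word_length G S (k \<otimes> inv g) \<le> word_length G S k + word_length G S g"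
      using word_length_mult_le[OF S', of k "inv g"] word_length_inv[OF S' gG] c gG by simp
    moreover have "word_length G S k \<le> (\<Sum>k\<in>F. word_length G S k)"
      using k F by (intro member_le_sum) auto
    ultimately show ?thesis using y by (simp add: m_def)
  qed
  then show ?thesis using word_length_dominated[OF S' K'] by blast
qed

lemma (in group_hom) foldr_mult_hom:
  "set ws \<subseteq> carrier G \<Longrightarrow>
    h (foldr (\<lambda>x y. x \<otimes>\<^bsub>G\<^esub> y) ws \<one>\<^bsub>G\<^esub>) = foldr (\<lambda>x y. x \<otimes>\<^bsub>H\<^esub> y) (map h ws) \<one>\<^bsub>H\<^esub>"
  by (induction ws) (auto simp: G.foldr_mult_closed)

text \<open>A word in the image of \<open>S\<close> lifts letter by letter to a word of the same length in \<open>S\<close>.\<close>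
lemma (in group_hom) word_length_image:
  assumes S: "S \<subseteq> carrier G" "generate G S = carrier G" and surj: "h ` carrier G = carrier H"
  shows "generate H (h ` S) = carrier H"
    and "g \<in> carrier G \<Longrightarrow> word_length H (h ` S) (h g) \<le> word_length G S g"
    and "q \<in> carrier H \<Longrightarrow> \<exists>g\<in>carrier G. h g = q \<and> word_length G S g \<le> word_length H (h ` S) q"
proof -
  show gen: "generate H (h ` S) = carrier H"
    using generate_img[OF S(1)] S(2) surj by simp
  have hS: "h ` S \<subseteq> carrier H" using S(1) by auto
  have letters: "h ` (S \<union> (\<lambda>s. inv\<^bsub>G\<^esub> s) ` S) = h ` S \<union> (\<lambda>s. inv\<^bsub>H\<^esub> s) ` (h ` S)"
    using S(1) by (auto simp: image_Un image_image subset_iff intro!: image_eqI)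
  have SG: "S \<union> (\<lambda>s. inv\<^bsub>G\<^esub> s) ` S \<subseteq> carrier G" by (rule G.symm_subset[OF S])
  show "word_length H (h ` S) (h g) \<le> word_length G S g" if g: "g \<in> carrier G" for g
  proof -
    obtain ws where ws: "length ws = word_length G S g" "set ws \<subseteq> S \<union> (\<lambda>s. inv\<^bsub>G\<^esub> s) ` S"
      "foldr (\<lambda>x y. x \<otimes>\<^bsub>G\<^esub> y) ws \<one>\<^bsub>G\<^esub> = g" using G.word_length_witness[OF S g] by blast
    have "set (map h ws) \<subseteq> h ` S \<union> (\<lambda>s. inv\<^bsub>H\<^esub> s) ` (h ` S)"
      using ws(2) unfolding letters[symmetric] by auto
    moreover have "foldr (\<lambda>x y. x \<otimes>\<^bsub>H\<^esub> y) (map h ws) \<one>\<^bsub>H\<^esub> = h g"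
      using foldr_mult_hom[OF order_trans[OF ws(2) SG]] ws(3) by simp
    ultimately show ?thesis using H.word_length_le[OF hS gen] ws(1) by fastforce
  qed
  show "\<exists>g\<in>carrier G. h g = q \<and> word_length G S g \<le> word_length H (h ` S) q"
    if q: "q \<in> carrier H" for q
  proof -
    obtain us where us: "length us = word_length H (h ` S) q"
      "set us \<subseteq> h ` S \<union> (\<lambda>s. inv\<^bsub>H\<^esub> s) ` (h ` S)" "foldr (\<lambda>x y. x \<otimes>\<^bsub>H\<^esub> y) us \<one>\<^bsub>H\<^esub> = q"
      using H.word_length_witness[OF hS gen q] by blast
    have "\<forall>u\<in>set us. \<exists>s. s \<in> S \<union> (\<lambda>s. inv\<^bsub>G\<^esub> s) ` S \<and> u = h s"
      using us(2) unfolding letters[symmetric] by blast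
    then obtain k where k: "\<And>u. u \<in> set us \<Longrightarrow> k u \<in> S \<union> (\<lambda>s. inv\<^bsub>G\<^esub> s) ` S \<and> u = h (k u)"
      by metis
    define ws where "ws = map k us"
    have ws: "set ws \<subseteq> S \<union> (\<lambda>s. inv\<^bsub>G\<^esub> s) ` S" "map h ws = us" "length ws = length us"
      using k by (auto simp: ws_def map_idI)
    have "set ws \<subseteq> carrier G" using ws(1) SG by auto
    then show ?thesis
      using foldr_mult_hom[of ws] G.foldr_mult_closed[of ws] ws us G.word_length_le[OF S ws(1)]
      by (intro bexI[of _ "foldr (\<lambda>x y. x \<otimes>\<^bsub>G\<^esub> y) ws \<one>\<^bsub>G\<^esub>"]) auto
  qed
qed

lemma (in group) word_metric_left_invariant:
  assumes S: "S \<subseteq> carrier G" "generate G S = carrier G"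
    and "g \<in> carrier G" "x \<in> carrier G" "y \<in> carrier G"
  shows "mdist (word_metric G S) (g \<otimes> x) (g \<otimes> y) = mdist (word_metric G S) x y"
proof -
  have "inv (g \<otimes> x) \<otimes> (g \<otimes> y) = inv x \<otimes> y"
    using assms by (simp add: inv_mult_group m_assoc inv_cancel_left)
  then show ?thesis using assms by (simp add: mdist_word_metric[OF S] word_dist_def)
qed

section \<open>Asymptotic cones as complete metric spaces\<close>

lemma nonprincipal_ultrafilter_ne_bot: "nonprincipal_ultrafilter_on I \<omega> \<Longrightarrow> \<omega> \<noteq> bot"
  by (simp add: nonprincipal_ultrafilter_on_def)

text \<open>The limit superior only sees large indices, but finitely many terms do not affect boundedness of the
  quotients. The index \<open>0\<close> is excluded since the value there is arbitrary.\<close>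
lemma precone_bound_iff:
  "x \<in> precone X e \<longleftrightarrow>
    (\<forall>n. x n \<in> mspace X) \<and> (\<exists>c\<ge>0. \<forall>n>0. mdist X (x n) e \<le> c * real n)"
proof (intro iffI conjI allI)
  assume x: "x \<in> precone X e"
  then show "x n \<in> mspace X" for n by (simp add: precone_def)
  have "limsup (\<lambda>n. ereal (mdist X (x n) e / real n)) < \<infinity>" using x by (simp add: precone_def)
  then obtain c where "limsup (\<lambda>n. ereal (mdist X (x n) e / real n)) < ereal c"
    using ereal_dense2 by blast
  then have "\<forall>\<^sub>F n in sequentially. ereal (mdist X (x n) e / real n) < ereal c"
    by (rule Limsup_lessD)
  then obtain N where N: "\<And>n. N \<le> n \<Longrightarrow> mdist X (x n) e / real n < c"
    by (auto simp: eventually_sequentially)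
  define c' where "c' = (\<Sum>n<N. mdist X (x n) e / real n) + \<bar>c\<bar>"
  have nn: "0 \<le> (\<Sum>n<N. mdist X (x n) e / real n)" by (intro sum_nonneg) simp
  have "mdist X (x n) e / real n \<le> c'" for n
  proof (cases "n < N")
    case True
    then have "mdist X (x n) e / real n \<le> (\<Sum>n<N. mdist X (x n) e / real n)"
      by (intro member_le_sum) auto
    then show ?thesis by (simp add: c'_def)
  next
    case False
    then show ?thesis using N[of n] nn by (simp add: c'_def)
  qed
  then have "mdist X (x n) e \<le> c' * real n" if "0 < n" for n
    using that by (metis of_nat_0_less_iff pos_divide_le_eq)
  moreover have "0 \<le> c'" using nn by (simp add: c'_def)
  ultimately show "\<exists>c\<ge>0. \<forall>n>0. mdist X (x n) e \<le> c * real n" by blast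
next
  assume a: "(\<forall>n. x n \<in> mspace X) \<and> (\<exists>c\<ge>0. \<forall>n>0. mdist X (x n) e \<le> c * real n)"
  then obtain c where c: "0 \<le> c" "\<And>n. 0 < n \<Longrightarrow> mdist X (x n) e \<le> c * real n" by blast
  have "mdist X (x n) e / real n \<le> c" for n
    using c by (cases "n = 0") (simp_all add: pos_divide_le_eq)
  then have "limsup (\<lambda>n. ereal (mdist X (x n) e / real n)) \<le> ereal c"
    by (intro Limsup_bounded) simp
  then have "limsup (\<lambda>n. ereal (mdist X (x n) e / real n)) < \<infinity>" by (rule le_less_trans) simp
  then show "x \<in> precone X e" using a by (simp add: precone_def)
qed

lemma precone_in_mspace: "x \<in> precone X e \<Longrightarrow> x n \<in> mspace X"
  by (simp add: precone_def)

lemma preconeI: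
  assumes "\<And>n. x n \<in> mspace X" "0 \<le> c" "\<And>n. 0 < n \<Longrightarrow> mdist X (x n) e \<le> c * real n"
  shows "x \<in> precone X e"
  using assms by (auto simp: precone_bound_iff)

lemma precone_const: "e \<in> mspace X \<Longrightarrow> (\<lambda>n. e) \<in> precone X e"
  by (rule preconeI[of _ _ 0]) auto

text \<open>Closure of precones under all operations needed here reduces to a termwise linear estimate by at
  most two given sequences of linear growth.\<close>
lemma preconeI_dominated:
  assumes "\<And>n. x n \<in> mspace X" and u: "u \<in> precone U a" and v: "v \<in> precone V b" and "0 \<le> k" "0 \<le> l"
    and le: "\<And>n. mdist X (x n) e \<le> k * mdist U (u n) a + l * mdist V (v n) b"
  shows "x \<in> precone X e"
proof -
  obtain c where c: "0 \<le> c" "\<And>n. 0 < n \<Longrightarrow> mdist U (u n) a \<le> c * real n"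
    using u by (auto simp: precone_bound_iff)
  obtain d where d: "0 \<le> d" "\<And>n. 0 < n \<Longrightarrow> mdist V (v n) b \<le> d * real n"
    using v by (auto simp: precone_bound_iff)
  show ?thesis
  proof (rule preconeI)
    show "0 \<le> k * c + l * d" using c d assms by simp
    fix n :: nat assume "0 < n"
    have "k * mdist U (u n) a + l * mdist V (v n) b \<le> k * (c * real n) + l * (d * real n)"
      using c(2) d(2) \<open>0 < n\<close> assms(4,5) by (intro add_mono mult_left_mono) auto
    then show "mdist X (x n) e \<le> (k * c + l * d) * real n"
      using le[of n] by (simp add: algebra_simps)
  qed fact
qed

text \<open>Membership in the precone is a bound along all indices, not only along the ultrafilter;
  replacing the exceptional terms by the base-point does not change the limit along the ultrafilter.\<close>
lemma precone_truncate:
  assumes e: "e \<in> mspace X" and x: "\<And>n. x n \<in> mspace X"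
    and c: "\<forall>\<^sub>F n in \<omega>. mdist X (x n) e \<le> c * real n"
  obtains y where "y \<in> precone X e" "\<forall>\<^sub>F n in \<omega>. y n = x n"
proof
  let ?y = "\<lambda>n. if mdist X (x n) e \<le> c * real n then x n else e"
  show "?y \<in> precone X e"
  proof (rule preconeI)
    fix n :: nat
    have "c * real n \<le> \<bar>c\<bar> * real n" by (simp add: mult_right_mono)
    then show "mdist X (?y n) e \<le> \<bar>c\<bar> * real n" using e by auto
  qed (use e x in auto)
  show "\<forall>\<^sub>F n in \<omega>. ?y n = x n" using c by eventually_elim simp
qed

lemma precone_dist_mono:
  assumes \<omega>: "nonprincipal_ultrafilter_on {1..} \<omega>"
    and X: "e \<in> mspace X" "x \<in> precone X e" "x' \<in> precone X e"
    and Y: "f \<in> mspace Y" "y \<in> precone Y f" "y' \<in> precone Y f"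
    and le: "\<And>n. mdist X (x n) (x' n) \<le> c * mdist Y (y n) (y' n)"
  shows "precone_dist \<omega> X x x' \<le> c * precone_dist \<omega> Y y y'"
proof (rule tendsto_le[OF nonprincipal_ultrafilter_ne_bot[OF \<omega>]])
  show "((\<lambda>n. c * (mdist Y (y n) (y' n) / real n)) \<longlongrightarrow> c * precone_dist \<omega> Y y y') \<omega>"
    by (intro tendsto_mult_left precone_dist_tendsto[OF \<omega> Y])
  show "((\<lambda>n. mdist X (x n) (x' n) / real n) \<longlongrightarrow> precone_dist \<omega> X x x') \<omega>"
    by (intro precone_dist_tendsto[OF \<omega> X])
  show "\<forall>\<^sub>F n in \<omega>. mdist X (x n) (x' n) / real n \<le> c * (mdist Y (y n) (y' n) / real n)"
    using divide_right_mono[OF le] by (simp add: always_eventually)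
qed

lemma precone_dist_leI:
  assumes \<omega>: "nonprincipal_ultrafilter_on {1..} \<omega>"
    and X: "e \<in> mspace X" "x \<in> precone X e" "x' \<in> precone X e"
    and le: "\<forall>\<^sub>F n in \<omega>. mdist X (x n) (x' n) / real n \<le> r"
  shows "precone_dist \<omega> X x x' \<le> r"
  by (rule tendsto_upperbound[OF precone_dist_tendsto[OF \<omega> X] le nonprincipal_ultrafilter_ne_bot[OF \<omega>]])

lemma cone_class_eq_iff:
  assumes "nonprincipal_ultrafilter_on {1..} \<omega>" "e \<in> mspace X" "x \<in> precone X e" "y \<in> precone X e"
  shows "cone_class \<omega> X e x = cone_class \<omega> X e y \<longleftrightarrow> precone_dist \<omega> X x y = 0"
  using eq_equiv_class_iff[OF equiv_cone_rel[OF assms(1,2)] assms(3,4)] assms(3,4)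
  by (simp add: cone_class_def cone_rel_def)

lemma cone_class_in_cone:
  assumes "nonprincipal_ultrafilter_on {1..} \<omega>" "e \<in> mspace X" "x \<in> precone X e"
  shows "cone_class \<omega> X e x \<in> mspace (asymptotic_cone \<omega> X e)"
  using assms by (simp add: mspace_cone cone_space_def cone_class_def quotientI)

lemma mdist_cone_class:
  assumes "nonprincipal_ultrafilter_on {1..} \<omega>" "e \<in> mspace X" "x \<in> precone X e" "y \<in> precone X e"
  shows "mdist (asymptotic_cone \<omega> X e) (cone_class \<omega> X e x) (cone_class \<omega> X e y) = precone_dist \<omega> X x y"
  using assms by (simp add: mdist_cone cone_dist_class)

lemma cone_cases:
  assumes "nonprincipal_ultrafilter_on {1..} \<omega>" "e \<in> mspace X" "A \<in> mspace (asymptotic_cone \<omega> X e)"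
  obtains x where "x \<in> precone X e" "A = cone_class \<omega> X e x"
  using assms cone_space_cases[OF assms(1,2)] by (auto simp: mspace_cone)

lemma in_cone_class_iff:
  "x \<in> precone X e \<Longrightarrow> y \<in> cone_class \<omega> X e x \<longleftrightarrow> y \<in> precone X e \<and> precone_dist \<omega> X x y = 0"
  by (auto simp: cone_class_def cone_rel_def)

text \<open>A diagonal argument. For each \<open>m\<close>, the distances at index \<open>n\<close> of the first \<open>m\<close> sequences are close
  to their limits for almost all \<open>n\<close>. Let \<open>\<mu> n\<close> be the largest such \<open>m \<le> n\<close>; it tends to infinity along
  the ultrafilter, and the sequence with terms \<open>x (\<mu> n) n\<close> represents the limit. It is of linear growth
  only for almost all indices, hence the truncation.\<close>
theorem asymptotic_cone_complete:
  assumes \<omega>: "nonprincipal_ultrafilter_on {1..} \<omega>" and e: "e \<in> mspace X"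
  shows "mcomplete_of (asymptotic_cone \<omega> X e)"
proof -
  let ?M = "asymptotic_cone \<omega> X e"
  interpret M: Metric_space "mspace ?M" "mdist ?M" by (rule Metric_space_mspace_mdist)
  have "\<exists>x. limitin M.mtopology \<sigma> x sequentially" if "M.MCauchy \<sigma>" for \<sigma>
  proof -
    have \<sigma>M: "\<sigma> k \<in> mspace ?M" for k using that by (auto simp: M.MCauchy_def)
    have cauchy: "\<exists>N. \<forall>j k. N \<le> j \<longrightarrow> N \<le> k \<longrightarrow> mdist ?M (\<sigma> j) (\<sigma> k) < r" if "0 < r" for r
      using \<open>M.MCauchy \<sigma>\<close> that by (simp add: M.MCauchy_def)
    have "\<exists>x. x \<in> precone X e \<and> \<sigma> k = cone_class \<omega> X e x" for k
      using cone_cases[OF \<omega> e \<sigma>M] by blast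
    then obtain x where x: "\<And>k. x k \<in> precone X e" and \<sigma>: "\<And>k. \<sigma> k = cone_class \<omega> X e (x k)"
      by metis
    define D where "D i j = precone_dist \<omega> X (x i) (x j)" for i j
    have \<sigma>D: "mdist ?M (\<sigma> i) (\<sigma> j) = D i j" for i j
      unfolding \<sigma> D_def by (rule mdist_cone_class[OF \<omega> e x x])
    define good where "good m n \<longleftrightarrow> (\<forall>i\<in>{..m}. \<forall>j\<in>{..m}.
        mdist X (x i n) (x j n) / real n \<le> D i j + inverse (real (Suc m)))" for m n
    have good: "\<forall>\<^sub>F n in \<omega>. good m n" for m
    proof -
      have "\<forall>\<^sub>F n in \<omega>. mdist X (x i n) (x j n) / real n \<le> D i j + inverse (real (Suc m))" for i j
        using order_tendstoD(2)[OF precone_dist_tendsto[OF \<omega> e x x],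
            of i j "D i j + inverse (real (Suc m))"]
        unfolding D_def by (auto elim!: eventually_mono)
      then show ?thesis
        unfolding good_def by (intro eventually_ball_finite ballI) auto
    qed
    \<comment> \<open>The bound \<open>m \<le> n\<close> makes the set finite, and the disjunct \<open>m = 0\<close> makes it nonempty.\<close>
    define \<mu> where "\<mu> n = Max {m. m \<le> n \<and> (m = 0 \<or> good m n)}" for n
    have fin: "finite {m. m \<le> n \<and> (m = 0 \<or> good m n)}" for n
      by (rule finite_subset[of _ "{..n}"]) auto
    have \<mu>: "m \<le> \<mu> n" "good (\<mu> n) n" if "m \<le> n" "good m n" for m n
    proof -
      show "m \<le> \<mu> n" unfolding \<mu>_def using that by (intro Max_ge fin) simp
      have "\<mu> n \<in> {m. m \<le> n \<and> (m = 0 \<or> good m n)}"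
        unfolding \<mu>_def by (intro Max_in fin) auto
      then show "good (\<mu> n) n" using that \<open>m \<le> \<mu> n\<close> by (auto simp: le_less)
    qed
    define y where "y n = x (\<mu> n) n" for n
    have close: "\<forall>\<^sub>F n in \<omega>. mdist X (x j n) (y n) / real n \<le> 2 * r"
      if "0 < r" and N: "\<And>j k. N \<le> j \<Longrightarrow> N \<le> k \<Longrightarrow> mdist ?M (\<sigma> j) (\<sigma> k) < r" and "N \<le> j"
      for r N j
    proof -
      obtain k where k: "inverse (real (Suc k)) < r" using reals_Archimedean \<open>0 < r\<close> by blast
      let ?m = "max j k"
      have "\<forall>\<^sub>F n in \<omega>. ?m \<le> n"
        using filter_leD[OF nonprincipal_ultrafilter_le_sequentially[OF \<omega>] eventually_ge_at_top] .
      with good[of ?m] show ?thesis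
      proof eventually_elim
        case (elim n)
        have "j \<le> \<mu> n" "k \<le> \<mu> n" using \<mu>(1)[of ?m n] elim by auto
        then have "inverse (real (Suc (\<mu> n))) \<le> inverse (real (Suc k))" by simp
        moreover have "mdist X (x j n) (y n) / real n \<le> D j (\<mu> n) + inverse (real (Suc (\<mu> n)))"
          using \<mu>(2)[of ?m n] elim \<open>j \<le> \<mu> n\<close> by (simp add: good_def y_def)
        moreover have "D j (\<mu> n) < r"
          using N[of j "\<mu> n"] \<open>N \<le> j\<close> \<open>j \<le> \<mu> n\<close> by (simp add: \<sigma>D)
        ultimately show ?case using k by linarith
      qed
    qed
    have yX: "y n \<in> mspace X" for n using precone_in_mspace[OF x] by (simp add: y_def)
    obtain N1 where N1: "\<And>j k. N1 \<le> j \<Longrightarrow> N1 \<le> k \<Longrightarrow> mdist ?M (\<sigma> j) (\<sigma> k) < 1"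
      using cauchy[of 1] by auto
    obtain c where c: "\<And>n. 0 < n \<Longrightarrow> mdist X (x N1 n) e \<le> c * real n"
      using x[of N1] by (auto simp: precone_bound_iff)
    have close1: "\<forall>\<^sub>F n in \<omega>. mdist X (x N1 n) (y n) / real n \<le> 2 * 1"
      by (rule close[of 1 N1 N1]) (use N1 in auto)
    have "\<forall>\<^sub>F n in \<omega>. n \<in> {1..}" using \<omega> by (simp add: nonprincipal_ultrafilter_on_def)
    with close1 have "\<forall>\<^sub>F n in \<omega>. mdist X (y n) e \<le> (2 + c) * real n"
    proof (eventually_elim)
      case (elim n)
      then have "mdist X (x N1 n) (y n) \<le> 2 * real n" by (simp add: pos_divide_le_eq)
      moreover have "mdist X (y n) e \<le> mdist X (x N1 n) (y n) + mdist X (x N1 n) e"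
        using mdist_triangle[OF yX precone_in_mspace[OF x] e, of n N1 n] by (simp add: mdist_commute)
      ultimately show ?case using c[of n] elim by (simp add: algebra_simps)
    qed
    then obtain z where z: "z \<in> precone X e" and zy: "\<forall>\<^sub>F n in \<omega>. z n = y n"
      by (rule precone_truncate[of e X y, OF e yX])
    have "limitin M.mtopology \<sigma> (cone_class \<omega> X e z) sequentially"
      unfolding M.limitin_metric
    proof (intro conjI allI impI)
      show "cone_class \<omega> X e z \<in> mspace ?M" using cone_class_in_cone[OF \<omega> e z] .
      fix r :: real assume "0 < r"
      then obtain N where N: "\<And>j k. N \<le> j \<Longrightarrow> N \<le> k \<Longrightarrow> mdist ?M (\<sigma> j) (\<sigma> k) < r / 3"
        using cauchy[of "r / 3"] by auto
      have "mdist ?M (\<sigma> j) (cone_class \<omega> X e z) < r" if "N \<le> j" for j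
      proof -
        have "\<forall>\<^sub>F n in \<omega>. mdist X (x j n) (y n) / real n \<le> 2 * (r / 3)"
          using close[OF _ N that] \<open>0 < r\<close> by simp
        with zy have "\<forall>\<^sub>F n in \<omega>. mdist X (x j n) (z n) / real n \<le> 2 * (r / 3)"
          by eventually_elim simp
        then have "precone_dist \<omega> X (x j) z \<le> 2 * (r / 3)" by (rule precone_dist_leI[OF \<omega> e x z])
        then show ?thesis using \<open>0 < r\<close> by (simp add: \<sigma> mdist_cone_class[OF \<omega> e x z])
      qed
      then show "\<forall>\<^sub>F j in sequentially. \<sigma> j \<in> mspace ?M \<and> mdist ?M (\<sigma> j) (cone_class \<omega> X e z) < r"
        using \<sigma>M by (auto simp: eventually_sequentially)
    qed
    then show ?thesis by blast
  qed
  then show ?thesis by (simp add: mcomplete_of_def M.mcomplete_def)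
qed

section \<open>Cones of a central extension\<close>

text \<open>The large-scale relation between invariant metrics on \<open>G\<close> and \<open>Q\<close> that passes to cones: up to the
  factor \<open>L\<close>, the metric of \<open>Y\<close> is the quotient metric of \<open>X\<close>.\<close>
locale metric_central_extension = group_hom G Q p
  for G (structure) and Q (structure) and p +
  fixes Z :: "'a set" and X :: "'a metric" and Y :: "'c metric" and L :: real and \<omega> :: "nat filter"
  assumes \<omega>: "nonprincipal_ultrafilter_on {1..} \<omega>"
    and Z: "subgroup Z G" and central: "z \<in> Z \<Longrightarrow> g \<in> carrier G \<Longrightarrow> z \<otimes>\<^bsub>G\<^esub> g = g \<otimes>\<^bsub>G\<^esub> z"
    and kernel: "kernel G Q p = Z"
    and mspace_X: "mspace X = carrier G" and mspace_Y: "mspace Y = carrier Q"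
    and left_invariant: "g \<in> carrier G \<Longrightarrow> x \<in> carrier G \<Longrightarrow> y \<in> carrier G \<Longrightarrow>
      mdist X (g \<otimes>\<^bsub>G\<^esub> x) (g \<otimes>\<^bsub>G\<^esub> y) = mdist X x y"
    and L_ge_1: "1 \<le> L"
    and p_lipschitz: "x \<in> carrier G \<Longrightarrow> y \<in> carrier G \<Longrightarrow> mdist Y (p x) (p y) \<le> L * mdist X x y"
    and p_lift: "x \<in> carrier G \<Longrightarrow> q \<in> carrier Q \<Longrightarrow>
      \<exists>x'\<in>carrier G. p x' = q \<and> mdist X x x' \<le> L * mdist Y (p x) q"
begin

abbreviation XZ where "XZ \<equiv> submetric X Z"
abbreviation preX where "preX \<equiv> precone X \<one>\<^bsub>G\<^esub>"
abbreviation preY where "preY \<equiv> precone Y \<one>\<^bsub>Q\<^esub>"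
abbreviation preZ where "preZ \<equiv> precone XZ \<one>\<^bsub>G\<^esub>"
abbreviation clX where "clX \<equiv> cone_class \<omega> X \<one>\<^bsub>G\<^esub>"
abbreviation clY where "clY \<equiv> cone_class \<omega> Y \<one>\<^bsub>Q\<^esub>"
abbreviation clZ where "clZ \<equiv> cone_class \<omega> XZ \<one>\<^bsub>G\<^esub>"

text \<open>All representatives yield the same class, so the unions here and below have only
  one distinct member (see \<open>cone_proj_class\<close> and \<open>cone_act_class\<close>); this follows the encoding of the
  multiplication of the cone group.\<close>
definition cone_proj where
  "cone_proj A = (\<Union>x\<in>A. clY (\<lambda>n. p (x n)))"

definition cone_act where
  "cone_act B A = (\<Union>z\<in>B. \<Union>x\<in>A. clX (\<lambda>n. x n \<otimes>\<^bsub>G\<^esub> z n))"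

lemma oneX: "\<one>\<^bsub>G\<^esub> \<in> mspace X" and oneY: "\<one>\<^bsub>Q\<^esub> \<in> mspace Y" and oneZ: "\<one>\<^bsub>G\<^esub> \<in> mspace XZ"
  using mspace_X mspace_Y subgroup.one_closed[OF Z] by simp_all

lemma preX_carrier: "x \<in> preX \<Longrightarrow> x n \<in> carrier G"
  using precone_in_mspace[of x X] mspace_X by simp

lemma preY_carrier: "y \<in> preY \<Longrightarrow> y n \<in> carrier Q"
  using precone_in_mspace[of y Y] mspace_Y by simp

lemma preZ_iff: "z \<in> preZ \<longleftrightarrow> z \<in> preX \<and> (\<forall>n. z n \<in> Z)"
  by (auto simp: precone_bound_iff)

lemma preZ_preX: "z \<in> preZ \<Longrightarrow> z \<in> preX" and preZ_Z: "z \<in> preZ \<Longrightarrow> z n \<in> Z"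
  by (simp_all add: preZ_iff)

lemma precone_dist_submetric: "precone_dist \<omega> XZ = precone_dist \<omega> X"
  by (simp add: precone_dist_def fun_eq_iff)

text \<open>Left and right translation by a central element agree.\<close>
lemma right_invariant:
  assumes "z \<in> Z" "x \<in> carrier G" "y \<in> carrier G"
  shows "mdist X (x \<otimes>\<^bsub>G\<^esub> z) (y \<otimes>\<^bsub>G\<^esub> z) = mdist X x y"
  using assms left_invariant[of z x y] central subgroup.mem_carrier[OF Z] by simp

lemma preX_mult:
  assumes "x \<in> preX" "y \<in> preX"
  shows "(\<lambda>n. x n \<otimes>\<^bsub>G\<^esub> y n) \<in> preX"
proof (rule preconeI_dominated[OF _ assms, of _ _ 1 1])
  fix n
  note c = preX_carrier[OF assms(1), of n] preX_carrier[OF assms(2), of n]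
  have "mdist X (x n \<otimes>\<^bsub>G\<^esub> y n) \<one>\<^bsub>G\<^esub> \<le> mdist X (x n \<otimes>\<^bsub>G\<^esub> y n) (x n) + mdist X (x n) \<one>\<^bsub>G\<^esub>"
    using c mspace_X by (intro mdist_triangle) auto
  moreover have "mdist X (x n \<otimes>\<^bsub>G\<^esub> y n) (x n) = mdist X (y n) \<one>\<^bsub>G\<^esub>"
    using left_invariant[of "x n" "y n" "\<one>\<^bsub>G\<^esub>"] c by simp
  ultimately show "mdist X (x n \<otimes>\<^bsub>G\<^esub> y n) \<one>\<^bsub>G\<^esub> \<le> 1 * mdist X (x n) \<one>\<^bsub>G\<^esub> + 1 * mdist X (y n) \<one>\<^bsub>G\<^esub>"
    by simp
qed (use preX_carrier assms mspace_X in auto)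

lemma preX_inv:
  assumes "x \<in> preX"
  shows "(\<lambda>n. inv\<^bsub>G\<^esub> (x n)) \<in> preX"
proof (rule preconeI_dominated[OF _ assms assms, of _ _ 1 0])
  fix n
  have "mdist X (inv\<^bsub>G\<^esub> (x n)) \<one>\<^bsub>G\<^esub> = mdist X \<one>\<^bsub>G\<^esub> (x n)"
    using left_invariant[of "x n" "inv\<^bsub>G\<^esub> (x n)" "\<one>\<^bsub>G\<^esub>"] preX_carrier[OF assms] by simp
  then show "mdist X (inv\<^bsub>G\<^esub> (x n)) \<one>\<^bsub>G\<^esub> \<le> 1 * mdist X (x n) \<one>\<^bsub>G\<^esub> + 0 * mdist X (x n) \<one>\<^bsub>G\<^esub>"
    by (simp add: mdist_commute)
qed (use preX_carrier assms mspace_X in auto)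

lemma preZ_mult:
  assumes "z \<in> preZ" "w \<in> preZ"
  shows "(\<lambda>n. z n \<otimes>\<^bsub>G\<^esub> w n) \<in> preZ"
  using assms preX_mult subgroup.m_closed[OF Z] by (simp add: preZ_iff)

lemma preY_proj:
  assumes "x \<in> preX"
  shows "(\<lambda>n. p (x n)) \<in> preY"
proof (rule preconeI_dominated[OF _ assms assms, of _ _ L 0])
  fix n
  show "mdist Y (p (x n)) \<one>\<^bsub>Q\<^esub> \<le> L * mdist X (x n) \<one>\<^bsub>G\<^esub> + 0 * mdist X (x n) \<one>\<^bsub>G\<^esub>"
    using p_lipschitz[OF preX_carrier[OF assms] G.one_closed] by simp
qed (use preX_carrier[OF assms] mspace_Y L_ge_1 in auto)

lemma preX_lift:
  assumes x: "x \<in> preX" and y: "y \<in> preY"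
  obtains x' where "x' \<in> preX" "\<And>n. p (x' n) = y n"
    "\<And>n. mdist X (x n) (x' n) \<le> L * mdist Y (p (x n)) (y n)"
proof -
  have "\<exists>x'\<in>carrier G. p x' = y n \<and> mdist X (x n) x' \<le> L * mdist Y (p (x n)) (y n)" for n
    using p_lift[OF preX_carrier[OF x] preY_carrier[OF y]] .
  then obtain x' where x': "\<And>n. x' n \<in> carrier G" "\<And>n. p (x' n) = y n"
    "\<And>n. mdist X (x n) (x' n) \<le> L * mdist Y (p (x n)) (y n)" by metis
  have "x' \<in> preX"
  proof (rule preconeI_dominated[OF _ x y, of _ _ "L * L + 1" L])
    fix n
    have c: "x n \<in> mspace X" "x' n \<in> mspace X" "p (x n) \<in> mspace Y" "y n \<in> mspace Y"
      using preX_carrier[OF x] x' preY_carrier[OF y] mspace_X mspace_Y by auto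
    have "mdist X (x' n) \<one>\<^bsub>G\<^esub> \<le> mdist X (x n) (x' n) + mdist X (x n) \<one>\<^bsub>G\<^esub>"
      using mdist_triangle[OF c(2,1) oneX] by (simp add: mdist_commute)
    moreover have "mdist Y (p (x n)) (y n) \<le> L * mdist X (x n) \<one>\<^bsub>G\<^esub> + mdist Y (y n) \<one>\<^bsub>Q\<^esub>"
      using mdist_triangle[OF c(3) oneY c(4)] p_lipschitz[OF preX_carrier[OF x] G.one_closed, of n]
      by (simp add: mdist_commute)
    then have "L * mdist Y (p (x n)) (y n)
        \<le> L * (L * mdist X (x n) \<one>\<^bsub>G\<^esub> + mdist Y (y n) \<one>\<^bsub>Q\<^esub>)"
      using L_ge_1 by (intro mult_left_mono) auto
    ultimately show "mdist X (x' n) \<one>\<^bsub>G\<^esub>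
        \<le> (L * L + 1) * mdist X (x n) \<one>\<^bsub>G\<^esub> + L * mdist Y (y n) \<one>\<^bsub>Q\<^esub>"
      using x'(3)[of n] by (simp add: algebra_simps)
  qed (use x'(1) mspace_X L_ge_1 in auto)
  then show thesis using that x' by blast
qed

lemmas clX_eq_iff = cone_class_eq_iff[OF \<omega> oneX]
lemmas clY_eq_iff = cone_class_eq_iff[OF \<omega> oneY]
lemmas clZ_eq_iff = cone_class_eq_iff[OF \<omega> oneZ]

text \<open>Left and right invariance show that multiplication is nonexpanding in each factor; this makes
  termwise multiplication well defined on cones.\<close>
lemma mult_dist_le:
  assumes "x \<in> preX" "x' \<in> preX" "z \<in> preZ" "z' \<in> preZ"
  shows "precone_dist \<omega> X (\<lambda>n. x n \<otimes>\<^bsub>G\<^esub> z n) (\<lambda>n. x' n \<otimes>\<^bsub>G\<^esub> z' n)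
    \<le> precone_dist \<omega> X x x' + precone_dist \<omega> X z z'"
proof -
  note z = preZ_preX[OF assms(3)] preZ_preX[OF assms(4)]
  have "precone_dist \<omega> X (\<lambda>n. x n \<otimes>\<^bsub>G\<^esub> z n) (\<lambda>n. x' n \<otimes>\<^bsub>G\<^esub> z n) = precone_dist \<omega> X x x'"
    using right_invariant[OF preZ_Z[OF assms(3)]] preX_carrier assms by (simp add: precone_dist_def)
  moreover have "precone_dist \<omega> X (\<lambda>n. x' n \<otimes>\<^bsub>G\<^esub> z n) (\<lambda>n. x' n \<otimes>\<^bsub>G\<^esub> z' n) = precone_dist \<omega> X z z'"
    using left_invariant preX_carrier assms z by (simp add: precone_dist_def)
  ultimately show ?thesis
    using precone_dist_triangle[OF \<omega> oneX preX_mult[OF assms(1) z(1)] preX_mult[OF assms(2) z(1)]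
        preX_mult[OF assms(2) z(2)]] by simp
qed

lemma cone_act_class:
  assumes "x \<in> preX" "z \<in> preZ"
  shows "cone_act (clZ z) (clX x) = clX (\<lambda>n. x n \<otimes>\<^bsub>G\<^esub> z n)"
  unfolding cone_act_def
proof (rule UN_UN_constant)
  show "z \<in> clZ z" "x \<in> clX x"
    using assms precone_dist_self[OF \<omega> oneX] precone_dist_self[OF \<omega> oneZ]
    by (auto simp: in_cone_class_iff)
  fix z' x' assume "z' \<in> clZ z" "x' \<in> clX x"
  then have *: "z' \<in> preZ" "x' \<in> preX" "precone_dist \<omega> X z z' = 0" "precone_dist \<omega> X x x' = 0"
    using assms by (auto simp: in_cone_class_iff precone_dist_submetric)
  note pre = preX_mult[OF assms(1) preZ_preX[OF assms(2)]] preX_mult[OF *(2) preZ_preX[OF *(1)]]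
  have "precone_dist \<omega> X (\<lambda>n. x n \<otimes>\<^bsub>G\<^esub> z n) (\<lambda>n. x' n \<otimes>\<^bsub>G\<^esub> z' n) = 0"
    using mult_dist_le[OF assms(1) *(2) assms(2) *(1)] *(3,4) precone_dist_nonneg[OF \<omega> oneX pre]
    by simp
  then show "clX (\<lambda>n. x' n \<otimes>\<^bsub>G\<^esub> z' n) = clX (\<lambda>n. x n \<otimes>\<^bsub>G\<^esub> z n)"
    using clX_eq_iff[OF pre] by simp
qed

lemma cone_group_mult_class:
  assumes "z \<in> preZ" "w \<in> preZ"
  shows "clZ z \<otimes>\<^bsub>cone_group \<omega> G XZ\<^esub> clZ w = clZ (\<lambda>n. z n \<otimes>\<^bsub>G\<^esub> w n)"
  unfolding cone_group_def monoid.simps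
proof (rule UN_UN_constant)
  show "z \<in> clZ z" "w \<in> clZ w"
    using assms precone_dist_self[OF \<omega> oneZ] by (auto simp: in_cone_class_iff)
  fix z' w' assume "z' \<in> clZ z" "w' \<in> clZ w"
  then have *: "z' \<in> preZ" "w' \<in> preZ" "precone_dist \<omega> X z z' = 0" "precone_dist \<omega> X w w' = 0"
    using assms by (auto simp: in_cone_class_iff precone_dist_submetric)
  note pre = preZ_mult[OF assms] preZ_mult[OF *(1,2)]
  have "precone_dist \<omega> X (\<lambda>n. z n \<otimes>\<^bsub>G\<^esub> w n) (\<lambda>n. z' n \<otimes>\<^bsub>G\<^esub> w' n) = 0"
    using mult_dist_le[OF preZ_preX[OF assms(1)] preZ_preX[OF *(1)] assms(2) *(2)] *(3,4)
      precone_dist_nonneg[OF \<omega> oneX pre[THEN preZ_preX]] by simp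
  then show "clZ (\<lambda>n. z' n \<otimes>\<^bsub>G\<^esub> w' n) = clZ (\<lambda>n. z n \<otimes>\<^bsub>G\<^esub> w n)"
    using clZ_eq_iff[OF pre] precone_dist_submetric by simp
qed

lemma proj_dist_le:
  assumes "x \<in> preX" "x' \<in> preX"
  shows "precone_dist \<omega> Y (\<lambda>n. p (x n)) (\<lambda>n. p (x' n)) \<le> L * precone_dist \<omega> X x x'"
  using assms p_lipschitz preX_carrier
  by (intro precone_dist_mono[OF \<omega> oneY _ _ oneX] preY_proj) auto

lemma cone_proj_class:
  assumes "x \<in> preX"
  shows "cone_proj (clX x) = clY (\<lambda>n. p (x n))"
proof -
  have "clY (\<lambda>n. p (x' n)) = clY (\<lambda>n. p (x n))" if "x' \<in> clX x" for x'
  proof -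
    have *: "x' \<in> preX" "precone_dist \<omega> X x x' = 0"
      using that assms by (auto simp: in_cone_class_iff)
    then have "precone_dist \<omega> Y (\<lambda>n. p (x n)) (\<lambda>n. p (x' n)) = 0"
      using proj_dist_le[OF assms *(1)] *(2)
        precone_dist_nonneg[OF \<omega> oneY preY_proj[OF assms] preY_proj[OF *(1)]] by simp
    then show ?thesis using clY_eq_iff[OF preY_proj[OF assms] preY_proj[OF *(1)]] by simp
  qed
  moreover have "x \<in> clX x"
    using assms precone_dist_self[OF \<omega> oneX] by (auto simp: in_cone_class_iff)
  ultimately show ?thesis unfolding cone_proj_def by blast
qed

text \<open>Lift the points \<open>p (x' n)\<close> to points \<open>w n\<close> near \<open>x n\<close>. The distance of \<open>x n\<close> and \<open>w n\<close> is sublinear, and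
  \<open>w n\<close> differs from \<open>x' n\<close> by the element \<open>z n\<close> of \<open>Z\<close>. Right invariance under \<open>z n\<close> then shows that
  \<open>x n\<close> times \<open>z n\<close> is at sublinear distance from \<open>x' n\<close>.\<close>
lemma cone_fibre:
  assumes x: "x \<in> preX" and x': "x' \<in> preX"
    and eq: "clY (\<lambda>n. p (x n)) = clY (\<lambda>n. p (x' n))"
  obtains z where "z \<in> preZ" "clX x' = clX (\<lambda>n. x n \<otimes>\<^bsub>G\<^esub> z n)"
proof -
  obtain w where w: "w \<in> preX" "\<And>n. p (w n) = p (x' n)"
    and d: "\<And>n. mdist X (x n) (w n) \<le> L * mdist Y (p (x n)) (p (x' n))"
    using preX_lift[OF x preY_proj[OF x']] by blast
  define z where "z n = inv\<^bsub>G\<^esub> (w n) \<otimes>\<^bsub>G\<^esub> x' n" for n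
  note c = preX_carrier[OF x] preX_carrier[OF x'] preX_carrier[OF w(1)]
  have "z n \<in> Z" for n
    unfolding kernel[symmetric] kernel_def z_def using c w(2) by simp
  then have z: "z \<in> preZ"
    unfolding preZ_iff z_def using preX_mult[OF preX_inv[OF w(1)] x'] by simp
  have "w n \<otimes>\<^bsub>G\<^esub> z n = x' n" for n
    unfolding z_def using c by (simp add: G.inv_cancel_left)
  then have "mdist X (x' n) (x n \<otimes>\<^bsub>G\<^esub> z n) = mdist X (x n) (w n)" for n
    using right_invariant[OF preZ_Z[OF z], of "w n" "x n" n] c by (simp add: mdist_commute)
  then have "precone_dist \<omega> X x' (\<lambda>n. x n \<otimes>\<^bsub>G\<^esub> z n)
      \<le> L * precone_dist \<omega> Y (\<lambda>n. p (x n)) (\<lambda>n. p (x' n))"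
    using d x x' z preX_mult preZ_preX by (intro precone_dist_mono[OF \<omega> oneX _ _ oneY] preY_proj) auto
  also have "\<dots> = 0" using eq clY_eq_iff preY_proj x x' by simp
  finally have "precone_dist \<omega> X x' (\<lambda>n. x n \<otimes>\<^bsub>G\<^esub> z n) = 0"
    using precone_dist_nonneg[OF \<omega> oneX x' preX_mult[OF x preZ_preX[OF z]]] by simp
  then have "clX x' = clX (\<lambda>n. x n \<otimes>\<^bsub>G\<^esub> z n)"
    using clX_eq_iff[OF x' preX_mult[OF x preZ_preX[OF z]]] by simp
  with z show thesis by (rule that)
qed

lemmas coneX_cases = cone_cases[OF \<omega> oneX]
lemmas coneY_cases = cone_cases[OF \<omega> oneY]
lemmas coneZ_cases = cone_cases[OF \<omega> oneZ]
lemmas clX_in = cone_class_in_cone[OF \<omega> oneX]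
lemmas clY_in = cone_class_in_cone[OF \<omega> oneY]
lemmas clZ_in = cone_class_in_cone[OF \<omega> oneZ]
lemmas clX_dist = mdist_cone_class[OF \<omega> oneX]
lemmas clY_dist = mdist_cone_class[OF \<omega> oneY]
lemmas clZ_dist = mdist_cone_class[OF \<omega> oneZ]

lemma carrier_cone_group: "carrier (cone_group \<omega> G XZ) = mspace (asymptotic_cone \<omega> XZ \<one>\<^bsub>G\<^esub>)"
  by (simp add: cone_group_def)

lemma one_cone_group: "\<one>\<^bsub>cone_group \<omega> G XZ\<^esub> = clZ (\<lambda>n. \<one>\<^bsub>G\<^esub>)"
  by (simp add: cone_group_def)

lemma ultrametric_fibration_cones:
  assumes ultra: "ultrametric (asymptotic_cone \<omega> XZ \<one>\<^bsub>G\<^esub>)"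
  shows "ultrametric_fibration (asymptotic_cone \<omega> X \<one>\<^bsub>G\<^esub>) (asymptotic_cone \<omega> Y \<one>\<^bsub>Q\<^esub>)
    (asymptotic_cone \<omega> XZ \<one>\<^bsub>G\<^esub>) (cone_group \<omega> G XZ) cone_proj cone_act L"
proof
  let ?X = "asymptotic_cone \<omega> X \<one>\<^bsub>G\<^esub>" and ?Y = "asymptotic_cone \<omega> Y \<one>\<^bsub>Q\<^esub>"
  let ?Z = "asymptotic_cone \<omega> XZ \<one>\<^bsub>G\<^esub>" and ?C = "cone_group \<omega> G XZ"
  have act_in: "(\<lambda>n. x n \<otimes>\<^bsub>G\<^esub> z n) \<in> preX" if "x \<in> preX" "z \<in> preZ" for x z
    using preX_mult preZ_preX that by blast
  show "mcomplete_of ?X" by (rule asymptotic_cone_complete[OF \<omega> oneX])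
  show "1 \<le> L" by (rule L_ge_1)
  show "ultrametric ?Z" by (rule ultra)
  show "carrier ?C = mspace ?Z" by (rule carrier_cone_group)
  show "\<one>\<^bsub>?C\<^esub> \<in> carrier ?C"
    by (simp add: carrier_cone_group one_cone_group clZ_in precone_const[OF oneZ])
  show "a \<otimes>\<^bsub>?C\<^esub> b \<in> carrier ?C" if ab: "a \<in> carrier ?C" "b \<in> carrier ?C" for a b
  proof -
    obtain z where "z \<in> preZ" "a = clZ z"
      using ab(1) unfolding carrier_cone_group by (rule coneZ_cases)
    moreover obtain w where "w \<in> preZ" "b = clZ w"
      using ab(2) unfolding carrier_cone_group by (rule coneZ_cases)
    ultimately show ?thesis
      by (simp add: cone_group_mult_class carrier_cone_group clZ_in preZ_mult)
  qed
  fix x assume "x \<in> mspace ?X"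
  then obtain u where u: "u \<in> preX" and x: "x = clX u" by (rule coneX_cases)
  show "cone_proj x \<in> mspace ?Y" by (simp add: x cone_proj_class u clY_in preY_proj)
  show "cone_act \<one>\<^bsub>?C\<^esub> x = x"
    using preX_carrier[OF u] by (simp add: x one_cone_group cone_act_class u precone_const[OF oneZ])
  show "\<exists>x'\<in>mspace ?X. cone_proj x' = y \<and> mdist ?X x x' \<le> L * mdist ?Y (cone_proj x) y"
    if y': "y \<in> mspace ?Y" for y
  proof -
    obtain v where v: "v \<in> preY" and y: "y = clY v" using y' by (rule coneY_cases)
    obtain u' where u': "u' \<in> preX" "\<And>n. p (u' n) = v n"
      "\<And>n. mdist X (u n) (u' n) \<le> L * mdist Y (p (u n)) (v n)" using preX_lift[OF u v] by blast
    have "precone_dist \<omega> X u u' \<le> L * precone_dist \<omega> Y (\<lambda>n. p (u n)) v"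
      by (rule precone_dist_mono[OF \<omega> oneX u u'(1) oneY preY_proj[OF u] v u'(3)])
    then show ?thesis
      using u u' v by (intro bexI[of _ "clX u'"])
        (auto simp: x y cone_proj_class clX_dist clY_dist preY_proj clX_in)
  qed
  {
    fix x' assume "x' \<in> mspace ?X"
    then obtain u' where u': "u' \<in> preX" and x': "x' = clX u'" by (rule coneX_cases)
    show "mdist ?Y (cone_proj x) (cone_proj x') \<le> L * mdist ?X x x'"
      using proj_dist_le[OF u u'] by (simp add: x x' cone_proj_class clX_dist clY_dist preY_proj u u')
    show "\<exists>a\<in>carrier ?C. x' = cone_act a x" if "cone_proj x = cone_proj x'"
    proof -
      have "clY (\<lambda>n. p (u n)) = clY (\<lambda>n. p (u' n))"
        using that by (simp add: x x' cone_proj_class u u')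
      from cone_fibre[OF u u' this] obtain z where z: "z \<in> preZ" "clX u' = clX (\<lambda>n. u n \<otimes>\<^bsub>G\<^esub> z n)" .
      then show ?thesis
        using u by (intro bexI[of _ "clZ z"]) (auto simp: x x' cone_act_class carrier_cone_group clZ_in)
    qed
    fix a assume "a \<in> carrier ?C"
    then obtain z where z: "z \<in> preZ" and a: "a = clZ z"
      unfolding carrier_cone_group by (rule coneZ_cases)
    show "mdist ?X (cone_act a x) (cone_act a x') = mdist ?X x x'"
      using right_invariant[OF preZ_Z[OF z]] preX_carrier u u' z
      by (simp add: x x' a cone_act_class clX_dist act_in precone_dist_def)
  }
  fix a assume "a \<in> carrier ?C"
  then obtain z where z: "z \<in> preZ" and a: "a = clZ z"
    unfolding carrier_cone_group by (rule coneZ_cases)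
  show "cone_act a x \<in> mspace ?X" by (simp add: x a cone_act_class u z clX_in act_in)
  have pz: "p (z n) = \<one>\<^bsub>Q\<^esub>" for n
    using preZ_Z[OF z, of n] unfolding kernel[symmetric] kernel_def by simp
  show "cone_proj (cone_act a x) = cone_proj x"
    using preX_carrier[OF u] preX_carrier[OF preZ_preX[OF z]]
    by (simp add: x a cone_act_class cone_proj_class u z act_in pz)
  fix b assume "b \<in> carrier ?C"
  then obtain w where w: "w \<in> preZ" and b: "b = clZ w"
    unfolding carrier_cone_group by (rule coneZ_cases)
  note c = preX_carrier[OF u] preX_carrier[OF preZ_preX[OF z]] preX_carrier[OF preZ_preX[OF w]]
  have "u n \<otimes>\<^bsub>G\<^esub> (z n \<otimes>\<^bsub>G\<^esub> w n) = (u n \<otimes>\<^bsub>G\<^esub> w n) \<otimes>\<^bsub>G\<^esub> z n" for n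
    using c central[OF preZ_Z[OF z], of "w n"] by (simp add: G.m_assoc)
  then show "cone_act (a \<otimes>\<^bsub>?C\<^esub> b) x = cone_act a (cone_act b x)"
    by (simp add: a b x cone_group_mult_class cone_act_class u z w act_in preZ_mult)
  show "mdist ?X (cone_act a x) (cone_act b x) = mdist ?Z a b"
    using left_invariant c
    by (simp add: a b x cone_act_class u z w act_in clX_dist clZ_dist precone_dist_submetric)
      (simp add: precone_dist_def)
qed

end

section \<open>The fundamental group of the cone of the quotient\<close>

text \<open>The image of \<open>S\<close> is a compact generating set of \<open>Q\<close>. For its word metric \<open>p\<close> is nonexpanding and lifts
  points without loss, and the word metric of \<open>S'\<close> is comparable to it.\<close>
lemma metric_central_extension_word_metrics:
  assumes G: "locally_compact_group G TG" and Q: "locally_compact_group Q TQ"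
    and ext: "central_extension Z G TG Q TQ p"
    and S: "compact_generating_set G TG S" and S': "compact_generating_set Q TQ S'"
    and \<omega>: "nonprincipal_ultrafilter_on {1..} \<omega>"
  shows "\<exists>L. metric_central_extension G Q p Z (word_metric G S) (word_metric Q S') L \<omega>"
proof -
  interpret G: group G using G by (simp add: locally_compact_group_def)
  interpret Q: group Q using Q by (simp add: locally_compact_group_def)
  have TG: "topspace TG = carrier G" and TQ: "topspace TQ = carrier Q"
    using G Q by (simp_all add: locally_compact_group_def)
  interpret group_hom G Q p
    using ext by unfold_locales (simp add: central_extension_def)
  have q: "quotient_map TG TQ p" using ext by (simp add: central_extension_def)
  have surj: "p ` carrier G = carrier Q" using quotient_imp_surjective_map[OF q] TG TQ by simp
  have gS: "S \<subseteq> carrier G" "generate G S = carrier G"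
    using S compactin_subset_topspace[of TG S] TG by (auto simp: compact_generating_set_def)
  have gS': "S' \<subseteq> carrier Q" "generate Q S' = carrier Q"
    using S' compactin_subset_topspace[of TQ S'] TQ by (auto simp: compact_generating_set_def)
  note im = word_length_image[OF gS surj]
  have pS: "compact_generating_set Q TQ (p ` S)"
    using image_compactin[OF _ quotient_imp_continuous_map[OF q]] S im(1)
    by (simp add: compact_generating_set_def)
  obtain k where k: "\<And>g. g \<in> carrier Q \<Longrightarrow> word_length Q S' g \<le> k * word_length Q (p ` S) g"
    using Q.word_length_comparable[OF Q S' pS] by blast
  obtain l where l: "\<And>g. g \<in> carrier Q \<Longrightarrow> word_length Q (p ` S) g \<le> l * word_length Q S' g"
    using Q.word_length_comparable[OF Q pS S'] by blast
  define L where "L = real (Suc (k + l))"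
  have up: "real (word_length Q S' (p g)) \<le> L * real (word_length G S g)" if "g \<in> carrier G" for g
  proof -
    have "word_length Q S' (p g) \<le> k * word_length Q (p ` S) (p g)" using k that by simp
    also have "\<dots> \<le> Suc (k + l) * word_length G S g" using im(2)[OF that] by (intro mult_mono) auto
    finally show ?thesis unfolding L_def of_nat_mult[symmetric] of_nat_le_iff .
  qed
  have down: "\<exists>g\<in>carrier G. p g = q \<and> real (word_length G S g) \<le> L * real (word_length Q S' q)"
    if q: "q \<in> carrier Q" for q
  proof -
    obtain g where g: "g \<in> carrier G" "p g = q" "word_length G S g \<le> word_length Q (p ` S) q"
      using im(3)[OF q] by blast
    note g(3)
    also have "word_length Q (p ` S) q \<le> l * word_length Q S' q" using l q by simp
    also have "\<dots> \<le> Suc (k + l) * word_length Q S' q" by (intro mult_mono) auto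
    finally have "real (word_length G S g) \<le> L * real (word_length Q S' q)"
      unfolding L_def of_nat_mult[symmetric] of_nat_le_iff .
    with g show ?thesis by blast
  qed
  have "metric_central_extension G Q p Z (word_metric G S) (word_metric Q S') L \<omega>"
  proof (intro metric_central_extension.intro metric_central_extension_axioms.intro)
    show "group_hom G Q p" by (rule group_hom_axioms)
    show "nonprincipal_ultrafilter_on {1..} \<omega>" by fact
    show "subgroup Z G" "kernel G Q p = Z" using ext by (simp_all add: central_extension_def)
    show "mspace (word_metric G S) = carrier G" "mspace (word_metric Q S') = carrier Q"
      by (simp_all add: G.mspace_word_metric[OF gS] Q.mspace_word_metric[OF gS'])
    show "1 \<le> L" by (simp add: L_def)
    show "z \<otimes>\<^bsub>G\<^esub> g = g \<otimes>\<^bsub>G\<^esub> z" if "z \<in> Z" "g \<in> carrier G" for z g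
      using ext that by (simp add: central_extension_def)
    show "mdist (word_metric G S) (g \<otimes>\<^bsub>G\<^esub> x) (g \<otimes>\<^bsub>G\<^esub> y) = mdist (word_metric G S) x y"
      if "g \<in> carrier G" "x \<in> carrier G" "y \<in> carrier G" for g x y
      by (rule G.word_metric_left_invariant[OF gS that])
    show "mdist (word_metric Q S') (p x) (p y) \<le> L * mdist (word_metric G S) x y"
      if "x \<in> carrier G" "y \<in> carrier G" for x y
      using up[of "inv\<^bsub>G\<^esub> x \<otimes>\<^bsub>G\<^esub> y"] that
      by (simp add: G.mdist_word_metric[OF gS] Q.mdist_word_metric[OF gS'] word_dist_def)
    show "\<exists>x'\<in>carrier G. p x' = q \<and>
        mdist (word_metric G S) x x' \<le> L * mdist (word_metric Q S') (p x) q"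
      if x: "x \<in> carrier G" and q: "q \<in> carrier Q" for x q
    proof -
      obtain g where g: "g \<in> carrier G" "p g = inv\<^bsub>Q\<^esub> (p x) \<otimes>\<^bsub>Q\<^esub> q"
        "real (word_length G S g) \<le> L * real (word_length Q S' (inv\<^bsub>Q\<^esub> (p x) \<otimes>\<^bsub>Q\<^esub> q))"
        using down[of "inv\<^bsub>Q\<^esub> (p x) \<otimes>\<^bsub>Q\<^esub> q"] x q by auto
      have "p (x \<otimes>\<^bsub>G\<^esub> g) = q" using g x q by (simp add: Q.inv_cancel_left)
      moreover have "inv\<^bsub>G\<^esub> x \<otimes>\<^bsub>G\<^esub> (x \<otimes>\<^bsub>G\<^esub> g) = g" using g x by (simp add: G.inv_cancel_left)
      ultimately show ?thesis
        using g x q by (intro bexI[of _ "x \<otimes>\<^bsub>G\<^esub> g"])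
          (simp_all add: G.mdist_word_metric[OF gS] Q.mdist_word_metric[OF gS'] word_dist_def)
    qed
  qed
  then show ?thesis by blast
qed

theorem theorem1p3:
  fixes G :: "('g, 'm) monoid_scheme" and TG :: "'g topology" and Z :: "'g set"
    and Q :: "('q, 'n) monoid_scheme" and TQ :: "'q topology" and p :: "'g \<Rightarrow> 'q"
    and S :: "'g set" and S' :: "'q set" and \<omega> :: "nat filter"
  assumes "locally_compact_group G TG" and "locally_compact_group Q TQ"
    and "central_extension Z G TG Q TQ p"
    and "compact_generating_set G TG S" and "compact_generating_set Q TQ S'"
    and "nonprincipal_ultrafilter_on {1..} \<omega>"
    and "simply_connected_space (mtopology_of (asymptotic_cone \<omega> (word_metric G S) \<one>\<^bsub>G\<^esub>))"
    and "ultrametric (asymptotic_cone \<omega> (submetric (word_metric G S) Z) \<one>\<^bsub>G\<^esub>)"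
  shows "fundamental_group (mtopology_of (asymptotic_cone \<omega> (word_metric Q S') \<one>\<^bsub>Q\<^esub>))
           (cone_class \<omega> (word_metric Q S') \<one>\<^bsub>Q\<^esub> (\<lambda>n. \<one>\<^bsub>Q\<^esub>))
         \<cong> cone_group \<omega> G (submetric (word_metric G S) Z)"
proof -
  obtain L where "metric_central_extension G Q p Z (word_metric G S) (word_metric Q S') L \<omega>"
    using metric_central_extension_word_metrics assms(1-6) by blast
  then interpret E: metric_central_extension G Q p Z "word_metric G S" "word_metric Q S'" L \<omega> .
  interpret F: ultrametric_fibration "asymptotic_cone \<omega> (word_metric G S) \<one>\<^bsub>G\<^esub>"
    "asymptotic_cone \<omega> (word_metric Q S') \<one>\<^bsub>Q\<^esub>"
    "asymptotic_cone \<omega> (submetric (word_metric G S) Z) \<one>\<^bsub>G\<^esub>"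
    "cone_group \<omega> G (submetric (word_metric G S) Z)" E.cone_proj E.cone_act L
    by (rule E.ultrametric_fibration_cones) fact
  have one: "(\<lambda>n. \<one>\<^bsub>G\<^esub>) \<in> precone (word_metric G S) \<one>\<^bsub>G\<^esub>"
    by (rule precone_const[OF E.oneX])
  have "E.cone_proj (cone_class \<omega> (word_metric G S) \<one>\<^bsub>G\<^esub> (\<lambda>n. \<one>\<^bsub>G\<^esub>))
      = cone_class \<omega> (word_metric Q S') \<one>\<^bsub>Q\<^esub> (\<lambda>n. \<one>\<^bsub>Q\<^esub>)"
    using E.cone_proj_class[OF one] by simp
  with F.fundamental_group_iso[OF assms(7) E.clX_in[OF one]] show ?thesis by simp
qed

end
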